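(* Let $R$ be a minimal $A_\infty$-algebra over a field $k$, let $n\ge3$, and let $X$ be a minimal right $A_n$-module over $R$. Let $\phi_n\colon X\otimes R^{\otimes n}\to X[n-2]$ be the map $$\phi_n=-m_2^X(1\otimes m_n)+\sum_{\substack{2<r+t+1<n\\ r+s+t=n+1}}(-1)^{r+st}m^X_{r+t+1}(1^{\otimes r}\otimes m_s\otimes1^{\otimes t}).$$ (a) The underlying $A_{n-1}$-structure on $X$ can be extended to an $A_{n+1}$-structure if and only if the class $[\phi_n*1]\in\operatorname{Ext}_R^{n,n-2}(X,X)$ vanishes. (b) If $[\phi_n*1]=0$, the set of $A_{n+1}$-structures on $X$ extending the underlying $A_{n-1}$-structure is in bijective correspondence with pairs of $R$-module maps $$\psi\colon X\otimes R^{\otimes n}\to X[n-2],\qquad \xi\colon X\otimes R^{\otimes(n+1)}\to X[n-1]$$ such that $\partial(\psi)=\phi_n*1$.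
   Context: Graded $k$-modules are $\mathbb Z$-graded; $C[n]_i=C_{i+n}$. Koszul signs: $(f\otimes g)(x\otimes y)=(-1)^{|g||x|}f(x)\otimes g(y)$, so $(f\otimes g)\circ(h\otimes j)=(-1)^{|g||h|}(f\circ h)\otimes(g\circ j)$. A minimal $A_\infty$-algebra $R$ is a graded $k$-module with maps $m_i\colon R^{\otimes i}\to R[i-2]$, $i\ge1$, $m_1=0$, with $\sum_{r+s+t=m}(-1)^{r+st}m_{r+t+1}(1^{\otimes r}\otimes m_s\otimes1^{\otimes t})=0$ for all $m\ge1$; $m_2$ makes $R$ an associative graded algebra, assumed unital. A minimal right $A_l$-module over $R$ is a graded $k$-module $X$ with maps $m_i^X\colon X\otimes R^{\otimes(i-1)}\to X[i-2]$, $1\le i\le l$, $m_1^X=0$, such that for each $m\le l$, $\sum_{r+s+t=m}(-1)^{r+st}m^X_{r+t+1}(1^{\otimes r}\otimes m_s\otimes1^{\otimes t})=0$, where $m_s$ denotes $m_s^X$ if $r=0$ and $m_s^R$ otherwise (the same convention is used in $\phi_n$). For $l\ge3$, $m_2^X$ makes $X$ a right module over the associative algebra $R$, assumed unital. For right $R$-modules $M,N$ let $\mathrm{Bar}^{\star,*}(M,N)=\operatorname{Hom}^*(M\otimes R^{\otimes(\star+1)},N)$ be the cochain complex of right $R$-module maps out of the bar resolution of $M$ (second grading: maps of degree $m$ are maps to $N[m]$); its coboundary $\partial$ is precomposition with the bar differential $x\otimes\zeta_1\otimes\cdots\otimes\zeta_{p+1}\mapsto x\zeta_1\otimes\zeta_2\otimes\cdots\otimes\zeta_{p+1}+\sum_{i=1}^{p}(-1)^i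 x\otimes\cdots\otimes\zeta_i\zeta_{i+1}\otimes\cdots\otimes\zeta_{p+1}$. Its cohomology is $\operatorname{Ext}_R^{\star,*}(M,N)$. For a map of graded $k$-modules $f\colon M\to N$ from a graded $k$-module to a right $R$-module, $f*1\colon M\otimes R\to N$ is its canonical extension to a map of right $R$-modules. Thus $\phi_n*1\in\mathrm{Bar}^{n,n-2}(X,X)$; it is a cocycle. *)

theory Defs
  imports Complex_Main "HOL-Library.FuncSet"
begin

text \<open>
  Conventions. A graded \<open>k\<close>-module is the whole of a type together with a scalar multiplication and
  an internal direct sum decomposition indexed by the integers. A linear map out of a tensor
  product is represented by the corresponding multilinear map, i.e. by its values on pure tensors:
  \<open>\<zeta>\<^sub>1 \<otimes> \<dots> \<otimes> \<zeta>\<^sub>i\<close> is the list \<open>[\<zeta>\<^sub>1, \<dots>, \<zeta>\<^sub>i]\<close>, and \<open>x \<otimes> \<zeta>\<^sub>1 \<otimes> \<dots> \<otimes> \<zeta>\<^sub>p\<close>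
  is the pair \<open>(x, [\<zeta>\<^sub>1, \<dots>, \<zeta>\<^sub>p])\<close>. Such maps are \<^const>\<open>extensional\<close>, so that equality of
  functions is equality of maps. A map of degree \<open>m\<close> is a degree-preserving map to the shift by \<open>m\<close>,
  and sends degree \<open>d\<close> to degree \<open>d + m\<close>.
\<close>

section \<open>Graded modules and maps out of tensor products\<close>

record ('k, 'v) gmod =
  scl :: "'k \<Rightarrow> 'v \<Rightarrow> 'v"
  gr :: "int \<Rightarrow> 'v set"

definition decomposes ::
  "('k, 'v::ab_group_add, 'z) gmod_scheme \<Rightarrow> 'v \<Rightarrow> (int \<Rightarrow> 'v) \<Rightarrow> bool" where
  "decomposes V v c \<longleftrightarrow>
     (\<forall>d. c d \<in> gr V d) \<and> finite {d. c d \<noteq> 0} \<and> v = (\<Sum>d | c d \<noteq> 0. c d)"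

definition graded_module :: "('k::field, 'v::ab_group_add, 'z) gmod_scheme \<Rightarrow> bool" where
  "graded_module V \<longleftrightarrow>
     vector_space (scl V) \<and>
     (\<forall>d. module.subspace (scl V) (gr V d)) \<and>
     (\<forall>v. \<exists>!c. decomposes V v c)"

definition part :: "('k, 'v::ab_group_add, 'z) gmod_scheme \<Rightarrow> 'v \<Rightarrow> int \<Rightarrow> 'v" where
  "part V v = (THE c. decomposes V v c)"

text \<open>
  Linear extension of \<open>x \<mapsto> (-1)\<^bsup>g |x|\<^esup> x\<close>: the Koszul sign acquired when a map of degree \<open>g\<close> is
  moved past \<open>x\<close>.
\<close>

definition koszul ::
  "('k::field, 'v::ab_group_add, 'z) gmod_scheme \<Rightarrow> int \<Rightarrow> 'v \<Rightarrow> 'v" where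
  "koszul V g v = (\<Sum>d | part V v d \<noteq> 0. scl V ((-1) powi (g * d)) (part V v d))"

text \<open>\<open>alg_hom R i m\<close>: maps from the \<open>i\<close>-th tensor power of \<open>R\<close> to \<open>R[m]\<close>.\<close>

definition alg_hom ::
  "('k::field, 'r::ab_group_add, 'z) gmod_scheme \<Rightarrow> nat \<Rightarrow> int \<Rightarrow> ('r list \<Rightarrow> 'r) set" where
  "alg_hom R i m = {f \<in> extensional {as. length as = i}.
     (\<forall>us vs. length us + 1 + length vs = i \<longrightarrow>
        Vector_Spaces.linear (scl R) (scl R) (\<lambda>a. f (us @ a # vs))) \<and>
     (\<forall>as ds. length as = i \<longrightarrow> list_all2 (\<lambda>a d. a \<in> gr R d) as ds \<longrightarrow>
        f as \<in> gr R (sum_list ds + m))}"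

definition words :: "nat \<Rightarrow> ('m \<times> 'r list) set" where
  "words p = {(x, zs). length zs = p}"

text \<open>\<open>mod_hom R M p N m\<close>: maps from \<open>M \<otimes> R \<otimes> \<dots> \<otimes> R\<close> (\<open>p\<close> factors \<open>R\<close>) to \<open>N[m]\<close>.\<close>

definition mod_hom ::
  "('k::field, 'r::ab_group_add, 'y) gmod_scheme \<Rightarrow> ('k, 'm::ab_group_add, 'z) gmod_scheme \<Rightarrow> nat \<Rightarrow>
   ('k, 'n::ab_group_add, 'w) gmod_scheme \<Rightarrow> int \<Rightarrow> ('m \<times> 'r list \<Rightarrow> 'n) set" where
  "mod_hom R M p N m = {f \<in> extensional (words p).
     (\<forall>zs. length zs = p \<longrightarrow> Vector_Spaces.linear (scl M) (scl N) (\<lambda>x. f (x, zs))) \<and>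
     (\<forall>x us vs. length us + 1 + length vs = p \<longrightarrow>
        Vector_Spaces.linear (scl R) (scl N) (\<lambda>a. f (x, us @ a # vs))) \<and>
     (\<forall>x zs d ds. length zs = p \<longrightarrow> x \<in> gr M d \<longrightarrow> list_all2 (\<lambda>a e. a \<in> gr R e) zs ds \<longrightarrow>
        f (x, zs) \<in> gr N (d + sum_list ds + m))}"

section \<open>Minimal A-infinity algebras and modules\<close>

text \<open>
  \<open>ins_alg R mR r s\<close> and \<open>ins_mod R mR X mX r s\<close> are the values of \<open>1\<^bsup>\<otimes>r\<^esup> \<otimes> m\<^sub>s \<otimes> 1\<^bsup>\<otimes>t\<^esup>\<close> on
  pure tensors, where \<open>t\<close> is determined by the length of the argument and \<open>m\<^sub>s\<close> has degree \<open>s - 2\<close>.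
\<close>

definition ins_alg ::
  "('k::field, 'r::ab_group_add, 'z) gmod_scheme \<Rightarrow> (nat \<Rightarrow> 'r list \<Rightarrow> 'r) \<Rightarrow>
   nat \<Rightarrow> nat \<Rightarrow> 'r list \<Rightarrow> 'r list" where
  "ins_alg R mR r s as =
     map (koszul R (int s - 2)) (take r as) @ mR s (take s (drop r as)) # drop (r + s) as"

definition ins_mod ::
  "('k::field, 'r::ab_group_add, 'y) gmod_scheme \<Rightarrow> (nat \<Rightarrow> 'r list \<Rightarrow> 'r) \<Rightarrow>
   ('k, 'x::ab_group_add, 'z) gmod_scheme \<Rightarrow> (nat \<Rightarrow> 'x \<times> 'r list \<Rightarrow> 'x) \<Rightarrow>
   nat \<Rightarrow> nat \<Rightarrow> 'x \<times> 'r list \<Rightarrow> 'x \<times> 'r list" where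
  "ins_mod R mR X mX r s w = (case w of (x, zs) \<Rightarrow>
     if r = 0 then (mX s (x, take (s - 1) zs), drop (s - 1) zs)
     else (koszul X (int s - 2) x, ins_alg R mR (r - 1) s zs))"

definition alg_unit :: "(nat \<Rightarrow> 'r list \<Rightarrow> 'r) \<Rightarrow> 'r \<Rightarrow> bool" where
  "alg_unit mR e \<longleftrightarrow> (\<forall>a. mR 2 [e, a] = a \<and> mR 2 [a, e] = a)"

definition minimal_A_inf_algebra ::
  "('k::field, 'r::ab_group_add, 'z) gmod_scheme \<Rightarrow> (nat \<Rightarrow> 'r list \<Rightarrow> 'r) \<Rightarrow> bool" where
  "minimal_A_inf_algebra R mR \<longleftrightarrow>
     graded_module R \<and>
     (\<forall>i\<ge>1. mR i \<in> alg_hom R i (int i - 2)) \<and>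
     (\<forall>a. mR 1 [a] = 0) \<and>
     (\<forall>m\<ge>1. \<forall>as. length as = m \<longrightarrow>
        (\<Sum>(r, s, t) \<in> {(r, s, t). 1 \<le> s \<and> r + s + t = m}.
           scl R ((-1) ^ (r + s * t)) (mR (r + t + 1) (ins_alg R mR r s as))) = 0) \<and>
     (\<exists>e \<in> gr R 0. alg_unit mR e)"

text \<open>
  The operations \<open>mX\<close> are indexed by \<open>{1..l}\<close> and extensional in the index as well, so that an
  \<open>A\<^sub>l\<close>-structure on \<open>X\<close> is determined by \<open>m\<^sub>1, \<dots>, m\<^sub>l\<close>.
\<close>

definition minimal_A_module ::
  "nat \<Rightarrow> ('k::field, 'r::ab_group_add, 'y) gmod_scheme \<Rightarrow> (nat \<Rightarrow> 'r list \<Rightarrow> 'r) \<Rightarrow>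
   ('k, 'x::ab_group_add, 'z) gmod_scheme \<Rightarrow> (nat \<Rightarrow> 'x \<times> 'r list \<Rightarrow> 'x) \<Rightarrow> bool" where
  "minimal_A_module l R mR X mX \<longleftrightarrow>
     graded_module X \<and>
     mX \<in> (\<Pi>\<^sub>E i\<in>{1..l}. mod_hom R X (i - 1) X (int i - 2)) \<and>
     (1 \<le> l \<longrightarrow> (\<forall>x. mX 1 (x, []) = 0)) \<and>
     (\<forall>m\<in>{1..l}. \<forall>w\<in>words (m - 1).
        (\<Sum>(r, s, t) \<in> {(r, s, t). 1 \<le> s \<and> r + s + t = m}.
           scl X ((-1) ^ (r + s * t)) (mX (r + t + 1) (ins_mod R mR X mX r s w))) = 0) \<and>
     (3 \<le> l \<longrightarrow> (\<forall>e. alg_unit mR e \<longrightarrow> (\<forall>x. mX 2 (x, [e]) = x)))"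

definition A_extensions ::
  "nat \<Rightarrow> nat \<Rightarrow> ('k::field, 'r::ab_group_add, 'y) gmod_scheme \<Rightarrow> (nat \<Rightarrow> 'r list \<Rightarrow> 'r) \<Rightarrow>
   ('k, 'x::ab_group_add, 'z) gmod_scheme \<Rightarrow> (nat \<Rightarrow> 'x \<times> 'r list \<Rightarrow> 'x) \<Rightarrow>
   (nat \<Rightarrow> 'x \<times> 'r list \<Rightarrow> 'x) set" where
  "A_extensions j l R mR X mX =
     {mX'. minimal_A_module l R mR X mX' \<and> restrict mX' {1..j} = restrict mX {1..j}}"

definition phi ::
  "('k::field, 'r::ab_group_add, 'y) gmod_scheme \<Rightarrow> (nat \<Rightarrow> 'r list \<Rightarrow> 'r) \<Rightarrow>
   ('k, 'x::ab_group_add, 'z) gmod_scheme \<Rightarrow> (nat \<Rightarrow> 'x \<times> 'r list \<Rightarrow> 'x) \<Rightarrow>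
   nat \<Rightarrow> 'x \<times> 'r list \<Rightarrow> 'x" where
  "phi R mR X mX n = restrict (\<lambda>w.
     - mX 2 (ins_mod R mR X mX 1 n w) +
     (\<Sum>(r, s, t) \<in> {(r, s, t). 2 < r + t + 1 \<and> r + t + 1 < n \<and> r + s + t = n + 1}.
        scl X ((-1) ^ (r + s * t)) (mX (r + t + 1) (ins_mod R mR X mX r s w)))) (words n)"

section \<open>The bar complex and Ext over an associative graded algebra\<close>

record ('k, 'r) galgebra = "('k, 'r) gmod" +
  mul :: "'r \<Rightarrow> 'r \<Rightarrow> 'r"

record ('k, 'r, 'm) gright_module = "('k, 'm) gmod" +
  act :: "'m \<Rightarrow> 'r \<Rightarrow> 'm"

definition assoc_algebra ::
  "('k, 'r, 'z) gmod_scheme \<Rightarrow> (nat \<Rightarrow> 'r list \<Rightarrow> 'r) \<Rightarrow> ('k, 'r) galgebra" where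
  "assoc_algebra R mR = \<lparr>scl = scl R, gr = gr R, mul = (\<lambda>a b. mR 2 [a, b])\<rparr>"

definition assoc_module ::
  "('k, 'x, 'z) gmod_scheme \<Rightarrow> (nat \<Rightarrow> 'x \<times> 'r list \<Rightarrow> 'x) \<Rightarrow> ('k, 'r, 'x) gright_module" where
  "assoc_module X mX = \<lparr>scl = scl X, gr = gr X, act = (\<lambda>x a. mX 2 (x, [a]))\<rparr>"

definition Bar ::
  "('k::field, 'r::ab_group_add) galgebra \<Rightarrow> ('k, 'r, 'm::ab_group_add) gright_module \<Rightarrow>
   ('k, 'r, 'n::ab_group_add) gright_module \<Rightarrow> nat \<Rightarrow> int \<Rightarrow> ('m \<times> 'r list \<Rightarrow> 'n) set" where
  "Bar A M N p m = {f \<in> mod_hom A M (p + 1) N m.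
     \<forall>x zs z a. length zs = p \<longrightarrow> f (x, zs @ [mul A z a]) = act N (f (x, zs @ [z])) a}"

text \<open>
  The coboundary from \<open>Bar\<^bsup>p,*\<^esup>\<close> to \<open>Bar\<^bsup>p+1,*\<^esup>\<close>; the list \<open>zs\<close> is \<open>[\<zeta>\<^sub>1, \<dots>, \<zeta>\<^bsub>p+2\<^esub>]\<close>, so that
  \<open>\<zeta>\<^sub>i\<close> is \<open>zs ! (i - 1)\<close>.
\<close>

definition bar_coboundary ::
  "('k::field, 'r::ab_group_add) galgebra \<Rightarrow> ('k, 'r, 'm::ab_group_add) gright_module \<Rightarrow>
   ('k, 'r, 'n::ab_group_add) gright_module \<Rightarrow> nat \<Rightarrow>
   ('m \<times> 'r list \<Rightarrow> 'n) \<Rightarrow> 'm \<times> 'r list \<Rightarrow> 'n" where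
  "bar_coboundary A M N p f = restrict (\<lambda>(x, zs).
     f (act M x (zs ! 0), drop 1 zs) +
     (\<Sum>i = 1..p + 1. scl N ((-1) ^ i)
        (f (x, take (i - 1) zs @ mul A (zs ! (i - 1)) (zs ! i) # drop (i + 1) zs)))) (words (p + 2))"

definition zero_cochain :: "nat \<Rightarrow> 'm \<times> 'r list \<Rightarrow> 'n::ab_group_add" where
  "zero_cochain p = restrict (\<lambda>_. 0) (words (p + 1))"

definition bar_cocycles ::
  "('k::field, 'r::ab_group_add) galgebra \<Rightarrow> ('k, 'r, 'm::ab_group_add) gright_module \<Rightarrow>
   ('k, 'r, 'n::ab_group_add) gright_module \<Rightarrow> nat \<Rightarrow> int \<Rightarrow> ('m \<times> 'r list \<Rightarrow> 'n) set" where
  "bar_cocycles A M N p m = {f \<in> Bar A M N p m. bar_coboundary A M N p f = zero_cochain (p + 1)}"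

definition bar_coboundaries ::
  "('k::field, 'r::ab_group_add) galgebra \<Rightarrow> ('k, 'r, 'm::ab_group_add) gright_module \<Rightarrow>
   ('k, 'r, 'n::ab_group_add) gright_module \<Rightarrow> nat \<Rightarrow> int \<Rightarrow> ('m \<times> 'r list \<Rightarrow> 'n) set" where
  "bar_coboundaries A M N p m =
     (if p = 0 then {zero_cochain 0} else bar_coboundary A M N (p - 1) ` Bar A M N (p - 1) m)"

definition cohomologous ::
  "('k::field, 'r::ab_group_add) galgebra \<Rightarrow> ('k, 'r, 'm::ab_group_add) gright_module \<Rightarrow>
   ('k, 'r, 'n::ab_group_add) gright_module \<Rightarrow> nat \<Rightarrow> int \<Rightarrow> ('m \<times> 'r list \<Rightarrow> 'n) rel" where
  "cohomologous A M N p m =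
     {(f, g). f \<in> bar_cocycles A M N p m \<and> g \<in> bar_cocycles A M N p m \<and>
        restrict (\<lambda>w. f w - g w) (words (p + 1)) \<in> bar_coboundaries A M N p m}"

definition Ext ::
  "('k::field, 'r::ab_group_add) galgebra \<Rightarrow> ('k, 'r, 'm::ab_group_add) gright_module \<Rightarrow>
   ('k, 'r, 'n::ab_group_add) gright_module \<Rightarrow> nat \<Rightarrow> int \<Rightarrow> ('m \<times> 'r list \<Rightarrow> 'n) set set" where
  "Ext A M N p m = bar_cocycles A M N p m // cohomologous A M N p m"

text \<open>The class of a cocycle, an element of \<^const>\<open>Ext\<close>; it is empty if \<open>f\<close> is not a cocycle.\<close>

definition Ext_class ::
  "('k::field, 'r::ab_group_add) galgebra \<Rightarrow> ('k, 'r, 'm::ab_group_add) gright_module \<Rightarrow>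
   ('k, 'r, 'n::ab_group_add) gright_module \<Rightarrow> nat \<Rightarrow> int \<Rightarrow>
   ('m \<times> 'r list \<Rightarrow> 'n) \<Rightarrow> ('m \<times> 'r list \<Rightarrow> 'n) set" where
  "Ext_class A M N p m f = cohomologous A M N p m `` {f}"

definition Ext_zero ::
  "('k::field, 'r::ab_group_add) galgebra \<Rightarrow> ('k, 'r, 'm::ab_group_add) gright_module \<Rightarrow>
   ('k, 'r, 'n::ab_group_add) gright_module \<Rightarrow> nat \<Rightarrow> int \<Rightarrow> ('m \<times> 'r list \<Rightarrow> 'n) set" where
  "Ext_zero A M N p m = Ext_class A M N p m (zero_cochain p)"

text \<open>
  \<open>star_one N p f\<close> is \<open>f * 1\<close> for a map \<open>f\<close> out of \<open>M \<otimes> R \<otimes> \<dots> \<otimes> R\<close> with \<open>p\<close> factors \<open>R\<close>; the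
  additional factor of its source is the last one.
\<close>

definition star_one ::
  "('k, 'r, 'n) gright_module \<Rightarrow> nat \<Rightarrow> ('m \<times> 'r list \<Rightarrow> 'n) \<Rightarrow> 'm \<times> 'r list \<Rightarrow> 'n" where
  "star_one N p f = restrict (\<lambda>(x, zs). act N (f (x, butlast zs)) (last zs)) (words (p + 1))"

end

theory Submission
  imports Defs
begin

text \<open>
  Because \<open>m\<^sub>1 = 0\<close>, the module equations up to \<open>n\<close> do not see \<open>m\<^sub>n\<close>, none of the equations up to
  \<open>n + 1\<close> sees \<open>m\<^bsub>n+1\<^esub>\<close>, and the equation for \<open>n + 1\<close> reads \<open>\<delta> m\<^sub>n + \<phi>\<^sub>n = 0\<close> for a Hochschild type
  differential \<open>\<delta>\<close>. The map \<open>f \<mapsto> f * 1\<close> is a bijection onto right module maps, with inverse evaluation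
  of the last factor at the unit, and satisfies \<open>\<partial>(f * 1) = (\<delta> f) * 1\<close>. Hence an extension is the same
  as the pair \<open>\<psi> = - m\<^sub>n * 1\<close>, \<open>\<xi> = m\<^bsub>n+1\<^esub> * 1\<close> with \<open>\<partial>\<psi> = \<phi>\<^sub>n * 1\<close>. That \<open>\<phi>\<^sub>n * 1\<close> is a cocycle is
  only needed when it is a coboundary, where it follows from \<open>\<partial>\<partial> = 0\<close>.
\<close>

section \<open>Graded modules over graded algebras\<close>

locale graded_algebra =
  fixes A :: "('k::field, 'r::ab_group_add) galgebra"
  assumes linear_mul_left: "Vector_Spaces.linear (scl A) (scl A) (\<lambda>a. mul A a b)"
    and linear_mul_right: "Vector_Spaces.linear (scl A) (scl A) (mul A a)"
    and mul_graded: "a \<in> gr A d \<Longrightarrow> b \<in> gr A e \<Longrightarrow> mul A a b \<in> gr A (d + e)"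
    and mul_assoc: "mul A (mul A a b) c = mul A a (mul A b c)"

locale graded_right_module = graded_algebra A
  for A :: "('k::field, 'r::ab_group_add) galgebra" +
  fixes M :: "('k, 'r, 'm::ab_group_add) gright_module"
  assumes vector_space_scl: "vector_space (scl M)"
    and subspace_gr: "module.subspace (scl M) (gr M d)"
    and linear_act_left: "Vector_Spaces.linear (scl M) (scl M) (\<lambda>x. act M x a)"
    and linear_act_right: "Vector_Spaces.linear (scl A) (scl M) (act M x)"
    and act_graded: "x \<in> gr M d \<Longrightarrow> a \<in> gr A e \<Longrightarrow> act M x a \<in> gr M (d + e)"
    and act_assoc: "act M (act M x a) b = act M x (mul A a b)"

sublocale graded_right_module \<subseteq> vs: vector_space "scl M"
  by (rule vector_space_scl)

lemma linear_comp:
  "Vector_Spaces.linear s1 s2 f \<Longrightarrow> Vector_Spaces.linear s2 s3 g \<Longrightarrow>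
    Vector_Spaces.linear s1 s3 (\<lambda>x. g (f x))"
  using Vector_Spaces.linear_compose[of s1 s2 f s3 g] by (simp add: comp_def)

lemma linear_sum_scale:
  assumes "vector_space s1" "vector_space s2" "\<And>i. i \<in> I \<Longrightarrow> Vector_Spaces.linear s1 s2 (f i)"
  shows "Vector_Spaces.linear s1 s2 (\<lambda>x. \<Sum>i\<in>I. s2 (c i) (f i x))"
proof -
  interpret vector_space_pair s1 s2
    using assms by (simp add: vector_space_pair_def)
  show ?thesis
    by (intro linear_compose_sum ballI linear_compose_scale_right assms)
qed

lemma linear_zero_arg: "Vector_Spaces.linear s1 s2 f \<Longrightarrow> f 0 = 0"
  using Vector_Spaces.linear.axioms(3) module_hom.zero by metis

section \<open>Faces of the bar construction\<close>

text \<open>Recursion on the position makes the identities below plain inductions. Positions count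
  from 0. The last clause leaves lists that are too short unchanged, so that an equation such as
  \<open>contract_append_right\<close> holds with no length condition. The operation stays a
  parameter because degree lists are later contracted with \<open>(+)\<close>.\<close>

fun contract :: "('r \<Rightarrow> 'r \<Rightarrow> 'r) \<Rightarrow> nat \<Rightarrow> 'r list \<Rightarrow> 'r list" where
  "contract m 0 (a # b # zs) = m a b # zs"
| "contract m (Suc i) (a # zs) = a # contract m i zs"
| "contract m i zs = zs"

lemma length_contract [simp]: "Suc i < length zs \<Longrightarrow> length (contract m i zs) = length zs - 1"
  by (induction m i zs rule: contract.induct) auto

lemma contract_conv:
  "Suc i < length zs \<Longrightarrow>
    contract m i zs = take i zs @ m (zs ! i) (zs ! Suc i) # drop (Suc (Suc i)) zs"
  by (induction m i zs rule: contract.induct) auto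

lemma contract_append_left: "Suc i < length us \<Longrightarrow> contract m i (us @ vs) = contract m i us @ vs"
  by (induction m i us rule: contract.induct) auto

lemma contract_append_right [simp]: "contract m (length us + i) (us @ vs) = us @ contract m i vs"
  by (induction us) auto

text \<open>This is the simplicial identity for inner faces. After stripping common leading entries
  \<open>i\<close> is 0: for \<open>j = 0\<close> three adjacent entries are multiplied and
  associativity decides, for larger \<open>j\<close> the two products involve disjoint
  pairs.\<close>

lemma contract_contract:
  assumes "\<And>a b c. m (m a b) c = m a (m b c)" "i \<le> j" "j + 2 < length zs"
  shows "contract m i (contract m (Suc j) zs) = contract m j (contract m i zs)"
  using assms(2,3)
proof (induction i arbitrary: j zs)
  case 0
  then obtain a b c vs where "zs = a # b # c # vs"
    by (metis Suc_le_length_iff add_2_eq_Suc' less_eq_Suc_le)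
  then show ?case using assms(1) by (cases j) auto
next
  case (Suc i)
  then obtain j' where "j = Suc j'" by (cases j) auto
  with Suc show ?case by (cases zs) auto
qed

text \<open>The summands of the bar differential without their signs. Letting the action be face 0
  puts all of them into one family indexed from 0.\<close>

fun face :: "('k, 'r) galgebra \<Rightarrow> ('k, 'r, 'm) gright_module \<Rightarrow> nat \<Rightarrow> 'm \<times> 'r list \<Rightarrow> 'm \<times> 'r list" where
  "face A M 0 (x, zs) = (act M x (hd zs), tl zs)"
| "face A M (Suc i) (x, zs) = (x, contract (mul A) i zs)"

lemma face_words: "w \<in> words (Suc p) \<Longrightarrow> i \<le> p \<Longrightarrow> face A M i w \<in> words p"
  by (cases i; cases w) (auto simp: words_def)

lemma face_append:
  "length zs = p \<Longrightarrow> i < p \<Longrightarrow> face A M i (x, zs @ vs) =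
    (fst (face A M i (x, zs)), snd (face A M i (x, zs)) @ vs)"
  by (cases i) (auto simp: contract_append_left)

lemma face_last:
  assumes "length zs = p"
  shows "face A M (Suc p) (x, zs @ [a, b]) = (x, zs @ [mul A a b])"
  using contract_append_right[of "mul A" zs 0 "[a, b]"] assms by simp

text \<open>With \<open>i = j = 0\<close> this is associativity of the action. With
  \<open>i = 0 < j\<close> the two faces touch different entries, and otherwise
  \<open>contract_contract\<close> applies.\<close>

lemma (in graded_right_module) face_face:
  assumes "i \<le> j" "j \<le> p" "w \<in> words (p + 2)"
  shows "face A M i (face A M (Suc j) w) = face A M j (face A M i w)"
proof -
  obtain x zs where w: "w = (x, zs)" "length zs = p + 2"
    using assms(3) by (auto simp: words_def)
  show ?thesis
  proof (cases i)
    case 0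
    obtain a b vs where "zs = a # b # vs"
      using w(2) by (metis Suc_length_conv add_2_eq_Suc')
    then show ?thesis using w 0 by (cases j) (auto simp: act_assoc)
  next
    case (Suc i')
    then obtain j' where "j = Suc j'" using assms(1) by (cases j) auto
    then show ?thesis
      using Suc w assms contract_contract[of "mul A" i' j' zs] by (auto simp: mul_assoc)
  qed
qed

section \<open>Graded multilinear maps and their pullback along faces\<close>

lemma mod_homI:
  assumes "f \<in> extensional (words p)"
    and "\<And>zs. length zs = p \<Longrightarrow> Vector_Spaces.linear (scl M) (scl N) (\<lambda>x. f (x, zs))"
    and "\<And>x us vs. length us + 1 + length vs = p \<Longrightarrow>
        Vector_Spaces.linear (scl R) (scl N) (\<lambda>a. f (x, us @ a # vs))"
    and "\<And>x zs d ds. length zs = p \<Longrightarrow> x \<in> gr M d \<Longrightarrow>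
        list_all2 (\<lambda>a e. a \<in> gr R e) zs ds \<Longrightarrow> f (x, zs) \<in> gr N (d + sum_list ds + m)"
  shows "f \<in> mod_hom R M p N m"
  using assms by (auto simp: mod_hom_def)

lemma
  assumes "f \<in> mod_hom R M p N m"
  shows mod_hom_extensional: "f \<in> extensional (words p)"
    and mod_hom_linear_left:
      "length zs = p \<Longrightarrow> Vector_Spaces.linear (scl M) (scl N) (\<lambda>x. f (x, zs))"
    and mod_hom_linear_right: "length us + 1 + length vs = p \<Longrightarrow>
        Vector_Spaces.linear (scl R) (scl N) (\<lambda>a. f (x, us @ a # vs))"
    and mod_hom_graded: "length zs = p \<Longrightarrow> x \<in> gr M d \<Longrightarrow>
        list_all2 (\<lambda>a e. a \<in> gr R e) zs ds \<Longrightarrow> f (x, zs) \<in> gr N (d + sum_list ds + m)"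
  using assms by (auto simp: mod_hom_def)

lemma mod_hom_cong:
  "scl R = scl R' \<Longrightarrow> gr R = gr R' \<Longrightarrow> scl M = scl M' \<Longrightarrow> gr M = gr M' \<Longrightarrow> scl N = scl N' \<Longrightarrow>
    gr N = gr N' \<Longrightarrow> mod_hom R M p N m = mod_hom R' M' p N' m"
  by (simp add: mod_hom_def)

lemma words_iff [simp]: "(x, zs) \<in> words p \<longleftrightarrow> length zs = p"
  by (simp add: words_def)

lemma (in graded_right_module) mod_hom_lincomb:
  assumes L: "vector_space (scl L)" and f: "\<And>i. i \<in> I \<Longrightarrow> f i \<in> mod_hom A L p M m"
  shows "restrict (\<lambda>w. \<Sum>i\<in>I. scl M (c i) (f i w)) (words p) \<in> mod_hom A L p M m"
proof (rule mod_homI)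
  have A: "vector_space (scl A)"
    using linear_mul_left by (rule Vector_Spaces.linear.axioms)
  fix x and zs us vs :: "'r list" and d ds
  show "Vector_Spaces.linear (scl L) (scl M)
      (\<lambda>x. restrict (\<lambda>w. \<Sum>i\<in>I. scl M (c i) (f i w)) (words p) (x, zs))" if "length zs = p"
    using linear_sum_scale[OF L vector_space_scl, of I "\<lambda>i x. f i (x, zs)" c]
      mod_hom_linear_left[OF f that] that by simp
  show "Vector_Spaces.linear (scl A) (scl M)
      (\<lambda>a. restrict (\<lambda>w. \<Sum>i\<in>I. scl M (c i) (f i w)) (words p) (x, us @ a # vs))"
    if "length us + 1 + length vs = p"
    using linear_sum_scale[OF A vector_space_scl, of I "\<lambda>i a. f i (x, us @ a # vs)" c]
      mod_hom_linear_right[OF f that] that by simp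
  show "restrict (\<lambda>w. \<Sum>i\<in>I. scl M (c i) (f i w)) (words p) (x, zs) \<in> gr M (d + sum_list ds + m)"
    if "length zs = p" "x \<in> gr L d" "list_all2 (\<lambda>a e. a \<in> gr A e) zs ds"
  proof -
    have "(\<Sum>i\<in>I. scl M (c i) (f i (x, zs))) \<in> gr M (d + sum_list ds + m)"
      using mod_hom_graded[OF f that]
      by (intro vs.subspace_sum[OF subspace_gr] vs.subspace_scale[OF subspace_gr])
    then show ?thesis using that(1) by simp
  qed
qed simp

text \<open>A product of homogeneous entries has the sum of their degrees, so the degree list of a
  face is the contraction of the degree list by \<open>(+)\<close>. Its total is unchanged, which is
  why pullback along a face keeps the degree of a map.\<close>

lemma sum_list_contract [simp]: "sum_list (contract (+) i ds) = (sum_list ds :: 'a::comm_monoid_add)"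
proof (induction i arbitrary: ds)
  case 0
  then show ?case by (cases ds; cases "tl ds") (auto simp: ac_simps)
next
  case (Suc i)
  then show ?case by (cases ds) auto
qed

lemma list_all2_contract:
  assumes "list_all2 P zs ds" "\<And>a b d e. P a d \<Longrightarrow> P b e \<Longrightarrow> P (m a b) (m' d e)"
  shows "list_all2 P (contract m i zs) (contract m' i ds)"
  using assms(1)
proof (induction i arbitrary: zs ds)
  case 0
  then show ?case
    using assms(2) by (cases zs; cases "tl zs") (auto simp: list_all2_Cons1)
next
  case (Suc i)
  then show ?case by (cases zs) (auto simp: list_all2_Cons1)
qed

lemma (in graded_right_module) face_mod_hom:
  assumes f: "f \<in> mod_hom A M p N m" and i: "i \<le> p"
  shows "restrict (\<lambda>w. f (face A M i w)) (words (Suc p)) \<in> mod_hom A M (Suc p) N m"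
proof (rule mod_homI)
  fix zs :: "'r list" assume zs: "length zs = Suc p"
  show "Vector_Spaces.linear (scl M) (scl N)
     (\<lambda>x. restrict (\<lambda>w. f (face A M i w)) (words (Suc p)) (x, zs))"
  proof (cases i)
    case 0
    then show ?thesis
      using zs linear_comp[OF linear_act_left mod_hom_linear_left[OF f, of "tl zs"]] by simp
  next
    case (Suc i')
    then show ?thesis using zs i by (auto intro!: mod_hom_linear_left[OF f])
  qed
next
  fix x and us vs :: "'r list" assume len: "length us + 1 + length vs = Suc p"
  have "Vector_Spaces.linear (scl A) (scl N) (\<lambda>a. f (face A M i (x, us @ a # vs)))"
  proof (cases i)
    case 0
    show ?thesis
    proof (cases us)
      case Nil
      then show ?thesis
        using 0 len linear_comp[OF linear_act_right mod_hom_linear_left[OF f, of vs]] by simp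
    next
      case (Cons u us')
      then show ?thesis using 0 len by (auto intro!: mod_hom_linear_right[OF f])
    qed
  next
    case (Suc i')
    \<comment> \<open>The multiplied pair occupies positions \<open>i'\<close> and
      \<open>Suc i'\<close>, the varying slot is at \<open>length us\<close>. The pair lies before
      the slot, ends in it, starts in it, or lies after it; in the two middle cases linearity of the
      multiplication enters.\<close>
    consider (before) "Suc i' < length us" | (left) "length us = Suc i'" | (right) "i' = length us"
      | (after) "length us < i'"
      by linarith
    then show ?thesis
    proof cases
      case before
      then show ?thesis
        using Suc len by (auto simp: contract_append_left intro!: mod_hom_linear_right[OF f])
    next
      case left
      then obtain u us' where us: "us = us' @ [u]"
        by (metis length_Suc_conv_rev)
      have "contract (mul A) i' (us @ a # vs) = us' @ mul A u a # vs" for a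
        using contract_append_right[of "mul A" us' 0 "u # a # vs"] left us by simp
      then show ?thesis
        using Suc len us linear_comp[OF linear_mul_right mod_hom_linear_right[OF f, of us' vs x]]
        by simp
    next
      case right
      then obtain v vs' where vs: "vs = v # vs'"
        using len Suc i by (cases vs) auto
      have "contract (mul A) i' (us @ a # vs) = us @ mul A a v # vs'" for a
        using contract_append_right[of "mul A" us 0 "a # v # vs'"] right vs by simp
      then show ?thesis
        using Suc len vs linear_comp[OF linear_mul_left mod_hom_linear_right[OF f, of us vs' x]]
        by simp
    next
      case after
      then obtain k where k: "i' = length us + Suc k"
        using less_imp_Suc_add by fastforce
      then have "contract (mul A) i' (us @ a # vs) = us @ a # contract (mul A) k vs" for a
        using contract_append_right[of "mul A" us "Suc k" "a # vs"] by simp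
      then show ?thesis
        using Suc len i k mod_hom_linear_right[OF f, of us "contract (mul A) k vs" x] by simp
    qed
  qed
  then show "Vector_Spaces.linear (scl A) (scl N)
     (\<lambda>a. restrict (\<lambda>w. f (face A M i w)) (words (Suc p)) (x, us @ a # vs))"
    using len by simp
next
  fix x d and zs :: "'r list" and ds
  assume zs: "length zs = Suc p" "list_all2 (\<lambda>a e. a \<in> gr A e) zs ds" and x: "x \<in> gr M d"
  have "f (face A M i (x, zs)) \<in> gr N (d + sum_list ds + m)"
  proof (cases i)
    case 0
    obtain a zs' where zs': "zs = a # zs'"
      using zs(1) by (cases zs) auto
    then obtain e ds' where "ds = e # ds'" "a \<in> gr A e" "list_all2 (\<lambda>a e. a \<in> gr A e) zs' ds'"
      using zs(2) by (auto simp: list_all2_Cons1)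
    then show ?thesis
      using 0 zs' zs(1) mod_hom_graded[OF f _ act_graded[OF x], of zs' a e ds']
      by (simp add: ac_simps)
  next
    case (Suc i')
    have "list_all2 (\<lambda>a e. a \<in> gr A e) (contract (mul A) i' zs) (contract (+) i' ds)"
      using zs(2) by (rule list_all2_contract) (rule mul_graded)
    then show ?thesis
      using Suc i zs(1) mod_hom_graded[OF f _ x, of "contract (mul A) i' zs" "contract (+) i' ds"]
      by simp
  qed
  then show "restrict (\<lambda>w. f (face A M i w)) (words (Suc p)) (x, zs) \<in> gr N (d + sum_list ds + m)"
    using zs(1) by simp
qed simp

section \<open>The bar complex\<close>

locale bar_complex = source: graded_right_module A M + target: graded_right_module A N
  for A :: "('k::field, 'r::ab_group_add) galgebra"
    and M :: "('k, 'r, 'm::ab_group_add) gright_module"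
    and N :: "('k, 'r, 'n::ab_group_add) gright_module"
begin

lemma BarI:
  assumes "f \<in> mod_hom A M (p + 1) N m"
    and "\<And>x zs z a. length zs = p \<Longrightarrow> f (x, zs @ [mul A z a]) = act N (f (x, zs @ [z])) a"
  shows "f \<in> Bar A M N p m"
  using assms by (simp add: Bar_def)

lemma act_sum_scale:
  "act N (\<Sum>i\<in>I. scl N (c i) (f i)) a = (\<Sum>i\<in>I. scl N (c i) (act N (f i) a))"
proof -
  interpret Vector_Spaces.linear "scl N" "scl N" "\<lambda>x. act N x a"
    by (rule target.linear_act_left)
  show ?thesis by (simp add: sum scale)
qed

text \<open>Differences, negatives and the zero cochain are the instances with two, one and no
  summands.\<close>

lemma Bar_lincomb:
  assumes "\<And>i. i \<in> I \<Longrightarrow> f i \<in> Bar A M N p m"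
  shows "restrict (\<lambda>w. \<Sum>i\<in>I. scl N (c i) (f i w)) (words (p + 1)) \<in> Bar A M N p m"
proof (rule BarI)
  show "restrict (\<lambda>w. \<Sum>i\<in>I. scl N (c i) (f i w)) (words (p + 1)) \<in> mod_hom A M (p + 1) N m"
    using assms by (intro target.mod_hom_lincomb source.vector_space_scl) (simp add: Bar_def)
qed (use assms in \<open>simp add: act_sum_scale Bar_def\<close>)

lemma Bar_diff:
  assumes "f \<in> Bar A M N p m" "g \<in> Bar A M N p m"
  shows "restrict (\<lambda>w. f w - g w) (words (p + 1)) \<in> Bar A M N p m"
  using Bar_lincomb[of UNIV "\<lambda>b. if b then f else g" p m "\<lambda>b. if b then 1 else - 1"] assms
  by (simp add: UNIV_bool)

lemma Bar_uminus:
  assumes "f \<in> Bar A M N p m"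
  shows "restrict (\<lambda>w. - f w) (words (p + 1)) \<in> Bar A M N p m"
  using Bar_lincomb[of "{()}" "\<lambda>_. f" p m "\<lambda>_. - 1"] assms by simp

lemma zero_cochain_Bar: "zero_cochain p \<in> Bar A M N p m"
  using Bar_lincomb[of "{}"] by (simp add: zero_cochain_def)

lemma bar_coboundary_face:
  "bar_coboundary A M N p f =
    restrict (\<lambda>w. \<Sum>i\<le>p + 1. scl N ((-1) ^ i) (f (face A M i w))) (words (p + 2))"
  unfolding bar_coboundary_def
proof (rule restrict_ext)
  fix w :: "'m \<times> 'r list" assume "w \<in> words (p + 2)"
  then obtain x zs where w: "w = (x, zs)" and zs: "length zs = p + 2"
    by (cases w) auto
  have "face A M i (x, zs) =
      (x, take (i - 1) zs @ mul A (zs ! (i - 1)) (zs ! i) # drop (i + 1) zs)"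
    if "i \<in> {1..p + 1}" for i
    using that zs contract_conv[of "i - 1" zs "mul A"] by (cases i) auto
  moreover have "face A M 0 (x, zs) = (act M x (zs ! 0), drop 1 zs)"
    using zs by (cases zs) auto
  moreover have "{..p + 1} = insert 0 {1..p + 1}" by auto
  ultimately show "(case w of (x, zs) \<Rightarrow> f (act M x (zs ! 0), drop 1 zs) +
      (\<Sum>i = 1..p + 1. scl N ((-1) ^ i)
        (f (x, take (i - 1) zs @ mul A (zs ! (i - 1)) (zs ! i) # drop (i + 1) zs)))) =
    (\<Sum>i\<le>p + 1. scl N ((-1) ^ i) (f (face A M i w)))"
    by (simp add: w del: face.simps sum.cl_ivl_Suc cong: sum.cong_simp)
qed

text \<open>Right linearity is checked face by face. Faces up to \<open>p\<close> do not touch the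
  last entry, so linearity of \<open>f\<close> suffices. Face \<open>p + 1\<close> multiplies into
  the last entry, where associativity turns \<open>b(za)\<close> into \<open>(bz)a\<close>
  first.\<close>

lemma bar_coboundary_Bar:
  assumes f: "f \<in> Bar A M N p m"
  shows "bar_coboundary A M N p f \<in> Bar A M N (Suc p) m"
proof (rule BarI)
  have "restrict (\<lambda>w. f (face A M i w)) (words (p + 2)) \<in> mod_hom A M (p + 2) N m" if "i \<le> p + 1" for i
    using source.face_mod_hom[of f "p + 1" N m i] f that by (simp add: Bar_def)
  then have "restrict (\<lambda>w. \<Sum>i\<in>{..p + 1}. scl N ((-1) ^ i)
      (restrict (\<lambda>w. f (face A M i w)) (words (p + 2)) w)) (words (p + 2)) \<in> mod_hom A M (p + 2) N m"
    using target.mod_hom_lincomb[OF source.vector_space_scl,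
        where f = "\<lambda>i. restrict (\<lambda>w. f (face A M i w)) (words (p + 2))"]
    by blast
  also have "restrict (\<lambda>w. \<Sum>i\<in>{..p + 1}. scl N ((-1) ^ i)
      (restrict (\<lambda>w. f (face A M i w)) (words (p + 2)) w)) (words (p + 2)) = bar_coboundary A M N p f"
    unfolding bar_coboundary_face by (rule restrict_ext) simp
  finally show "bar_coboundary A M N p f \<in> mod_hom A M (Suc p + 1) N m" by simp
next
  fix x and zs :: "'r list" and z a assume zs: "length zs = Suc p"
  have "f (face A M i (x, zs @ [mul A z a])) = act N (f (face A M i (x, zs @ [z]))) a"
    if "i \<le> p + 1" for i
  proof (cases "i \<le> p")
    case True
    define w where "w = face A M i (x, zs)"
    have "w \<in> words p"
      unfolding w_def using zs True by (intro face_words) auto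
    then show ?thesis
      using f True zs by (cases w) (simp add: Bar_def face_append flip: w_def)
  next
    case False
    moreover obtain us b where "zs = us @ [b]" "length us = p"
      using zs by (metis length_Suc_conv_rev)
    moreover have "i = Suc p" using False that by simp
    ultimately show ?thesis
      using f by (simp add: Bar_def face_last source.mul_assoc[symmetric] del: face.simps)
  qed
  then show "bar_coboundary A M N p f (x, zs @ [mul A z a]) =
      act N (bar_coboundary A M N p f (x, zs @ [z])) a"
    using zs by (simp add: bar_coboundary_face act_sum_scale del: sum.atMost_Suc cong: sum.cong_simp)
qed

text \<open>The double sum over \<open>(j, i)\<close> splits into \<open>i < j\<close> and its
  complement. The bijection sending \<open>(j, i)\<close> to \<open>(i, j - 1)\<close> matches the
  two halves: the composites agree by \<open>face_face\<close>, and the index total drops by one, so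
  the signs are opposite.\<close>

lemma bar_coboundary_square:
  "bar_coboundary A M N (Suc p) (bar_coboundary A M N p f) = zero_cochain (p + 2)"
proof -
  have "(\<Sum>j\<le>p + 2. scl N ((-1) ^ j)
      (\<Sum>i\<le>p + 1. scl N ((-1) ^ i) (f (face A M i (face A M j w))))) = 0"
    if w: "w \<in> words (p + 3)" for w
  proof -
    define T where "T = (\<lambda>(j, i). scl N ((-1) ^ (j + i)) (f (face A M i (face A M j w))))"
    define P where "P = {..p + 2} \<times> {..p + 1}"
    have "(\<Sum>j\<le>p + 2. scl N ((-1) ^ j)
        (\<Sum>i\<le>p + 1. scl N ((-1) ^ i) (f (face A M i (face A M j w))))) = sum T P"
      unfolding P_def T_def
      by (simp add: target.vs.scale_sum_right power_add sum.cartesian_product del: sum.atMost_Suc)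
    also have "\<dots> = sum T {(j, i) \<in> P. i < j} + sum T {(j, i) \<in> P. \<not> i < j}"
      by (subst sum.union_disjoint[symmetric])
        (auto simp: P_def intro: sum.cong finite_subset[of _ P, unfolded P_def])
    also have "sum T {(j, i) \<in> P. i < j} = (\<Sum>q\<in>{(j, i) \<in> P. \<not> i < j}. - T q)"
    proof (rule sum.reindex_bij_witness[where i = "\<lambda>(j, i). (Suc i, j)" and j = "\<lambda>(j, i). (i, j - 1)"])
      fix q assume q: "q \<in> {(j, i) \<in> P. i < j}"
      then obtain j i where ji: "q = (Suc j, i)" "i \<le> j" "j \<le> p + 1"
        by (cases q; cases "fst q") (auto simp: P_def)
      then have "face A M i (face A M (Suc j) w) = face A M j (face A M i w)"
        using w by (intro source.face_face[where p = "p + 1"]) (auto simp: eval_nat_numeral)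
      then show "- T (case q of (j, i) \<Rightarrow> (i, j - 1)) = T q"
        by (simp add: ji T_def add.commute)
    qed (auto simp: P_def)
    finally show ?thesis by (simp add: sum_negf)
  qed
  moreover have "face A M j w \<in> words (p + 2)" if "w \<in> words (p + 3)" "j \<le> p + 2" for j w
    using that by (intro face_words) (auto simp: eval_nat_numeral)
  ultimately show ?thesis
    unfolding bar_coboundary_face zero_cochain_def
    by (intro ext) (simp add: restrict_def eval_nat_numeral del: sum.atMost_Suc cong: sum.cong_simp)
qed

section \<open>Cocycles, coboundaries and vanishing of Ext classes\<close>

lemma bar_coboundary_diff:
  "bar_coboundary A M N p (restrict (\<lambda>w. f w - g w) (words (p + 1))) =
    restrict (\<lambda>w. bar_coboundary A M N p f w - bar_coboundary A M N p g w) (words (p + 2))"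
  unfolding bar_coboundary_face
proof (rule restrict_ext)
  fix w :: "'m \<times> 'r list" assume w: "w \<in> words (p + 2)"
  then have "face A M i w \<in> words (p + 1)" if "i \<le> p + 1" for i
    using that by (intro face_words) auto
  then show "(\<Sum>i\<le>p + 1. scl N ((-1) ^ i)
      (restrict (\<lambda>w. f w - g w) (words (p + 1)) (face A M i w))) =
    restrict (\<lambda>w. \<Sum>i\<le>p + 1. scl N ((-1) ^ i) (f (face A M i w))) (words (p + 2)) w -
    restrict (\<lambda>w. \<Sum>i\<le>p + 1. scl N ((-1) ^ i) (g (face A M i w))) (words (p + 2)) w"
    using w by (simp add: target.vs.scale_right_diff_distrib sum_subtractf
        del: sum.atMost_Suc cong: sum.cong_simp)
qed

lemma bar_coboundary_zero: "bar_coboundary A M N p (zero_cochain p) = zero_cochain (Suc p)"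
  using bar_coboundary_diff[of p "\<lambda>_. 0" "\<lambda>_. 0"] by (simp add: zero_cochain_def)

lemma bar_coboundaries_subset: "bar_coboundaries A M N p m \<subseteq> bar_cocycles A M N p m"
proof (cases p)
  case 0
  then show ?thesis
    using zero_cochain_Bar bar_coboundary_zero[of 0]
    by (auto simp: bar_coboundaries_def bar_cocycles_def)
next
  case (Suc q)
  then show ?thesis
    using bar_coboundary_Bar bar_coboundary_square
    by (auto simp: bar_coboundaries_def bar_cocycles_def)
qed

lemma bar_coboundaries_diff:
  assumes "f \<in> bar_coboundaries A M N p m" "g \<in> bar_coboundaries A M N p m"
  shows "restrict (\<lambda>w. f w - g w) (words (p + 1)) \<in> bar_coboundaries A M N p m"
proof (cases p)
  case 0
  then show ?thesis using assms by (simp add: bar_coboundaries_def zero_cochain_def cong: restrict_cong)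
next
  case (Suc q)
  then obtain f' g' where "f' \<in> Bar A M N q m" "f = bar_coboundary A M N q f'"
    "g' \<in> Bar A M N q m" "g = bar_coboundary A M N q g'"
    using assms by (auto simp: bar_coboundaries_def)
  then show ?thesis
    using Suc Bar_diff[of f' q m g'] bar_coboundary_diff[of q f' g', symmetric]
    by (auto simp: bar_coboundaries_def)
qed

lemma zero_cochain_bar_coboundaries: "zero_cochain p \<in> bar_coboundaries A M N p m"
  using zero_cochain_Bar bar_coboundary_zero
  by (cases p) (auto simp: bar_coboundaries_def image_iff intro!: bexI[of _ "zero_cochain _"])

text \<open>The class of a non-cocycle is empty while \<open>Ext_zero\<close> contains the zero
  cochain, so equality of classes already includes the cocycle condition. In the other direction a
  coboundary is a cocycle because the coboundary squares to zero.\<close>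

lemma Ext_class_eq_Ext_zero_iff:
  "Ext_class A M N p m f = Ext_zero A M N p m \<longleftrightarrow> f \<in> bar_coboundaries A M N p m"
proof
  let ?B = "bar_coboundaries A M N p m" and ?Z = "bar_cocycles A M N p m"
  let ?d = "\<lambda>f g :: 'm \<times> 'r list \<Rightarrow> 'n. restrict (\<lambda>w. f w - g w) (words (p + 1))"
  have zero: "zero_cochain p \<in> ?B" "zero_cochain p \<in> ?Z"
    using zero_cochain_bar_coboundaries bar_coboundaries_subset by blast+
  have ext: "f \<in> extensional (words (p + 1))" if "f \<in> ?Z" for f
    using that mod_hom_extensional by (auto simp: bar_cocycles_def Bar_def)
  have [simplified, simp]: "?d f (zero_cochain p) = f" if "f \<in> ?Z" for f
    using ext[OF that] by (auto simp: zero_cochain_def restrict_def extensional_def fun_eq_iff)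
  have [simp]: "restrict (\<lambda>_. 0) (words (Suc p)) = zero_cochain p"
    by (simp add: zero_cochain_def)
  {
    assume "Ext_class A M N p m f = Ext_zero A M N p m"
    moreover have "zero_cochain p \<in> Ext_zero A M N p m"
      using zero by (auto simp: Ext_zero_def Ext_class_def cohomologous_def)
    ultimately have "zero_cochain p \<in> Ext_class A M N p m f" by simp
    then show "f \<in> ?B"
      by (auto simp: Ext_class_def cohomologous_def)
  next
    assume f: "f \<in> ?B"
    then have fZ: "f \<in> ?Z" using bar_coboundaries_subset by auto
    \<comment> \<open>Taken with \<open>h = f\<close> and with \<open>h = zero_cochain p\<close>,
      this shows that each of the two classes consists of exactly the coboundaries.\<close>
    have "?d h g \<in> ?B \<longleftrightarrow> g \<in> ?B" if g: "g \<in> ?Z" and h: "h \<in> ?B" for g h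
    proof
      have "?d h (?d h g) = g"
        using ext[OF g] by (auto simp: restrict_def extensional_def fun_eq_iff)
      then show "g \<in> ?B" if "?d h g \<in> ?B"
        using bar_coboundaries_diff[OF h that] by simp
    qed (rule bar_coboundaries_diff[OF h])
    then show "Ext_class A M N p m f = Ext_zero A M N p m"
      using f fZ zero by (auto simp: Ext_class_def Ext_zero_def cohomologous_def)
  }
qed

end

section \<open>Extending maps to right module maps\<close>

context bar_complex
begin

text \<open>A Hochschild type coboundary from maps with \<open>p\<close> factors of the algebra to
  maps with \<open>p + 1\<close> factors. Its final summand is what becomes of face
  \<open>p + 1\<close> of the bar construction when the last factor of a right linear map is split
  off.\<close>

definition delta :: "nat \<Rightarrow> ('m \<times> 'r list \<Rightarrow> 'n) \<Rightarrow> 'm \<times> 'r list \<Rightarrow> 'n" where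
  "delta p f = (\<lambda>(x, zs). (\<Sum>i\<le>p. scl N ((-1) ^ i) (f (face A M i (x, zs)))) +
    scl N ((-1) ^ Suc p) (act N (f (x, butlast zs)) (last zs)))"

text \<open>On a word ending in \<open>a, b\<close> the faces up to \<open>p\<close> leave
  \<open>b\<close> alone and give the first sum of \<open>delta\<close>, acted on by
  \<open>b\<close>. Face \<open>p + 1\<close> gives the action of \<open>ab\<close> on
  \<open>f (x, zs)\<close>, which is the action of \<open>a\<close> followed by that of
  \<open>b\<close>, hence the final summand of \<open>delta\<close>.\<close>

lemma bar_coboundary_star_one:
  "bar_coboundary A M N p (star_one N p f) = star_one N (Suc p) (delta p f)"
  unfolding bar_coboundary_face star_one_def[of N "Suc p"]
proof (simp only: add_2_eq_Suc' Suc_eq_plus1[symmetric], rule restrict_ext)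
  fix w :: "'m \<times> 'r list" assume "w \<in> words (Suc (Suc p))"
  then obtain x zs a b where w: "w = (x, zs @ [a, b])" and zs: "length zs = p"
    by (cases w) (auto simp: length_Suc_conv_rev)
  have "star_one N p f (face A M i w) = act N (f (face A M i (x, zs @ [a]))) b" if "i \<le> p" for i
  proof -
    define v where "v = face A M i (x, zs @ [a])"
    have "v \<in> words p"
      unfolding v_def using zs that by (intro face_words) auto
    then show ?thesis
      using that zs face_append[of "zs @ [a]" "Suc p" i A M x "[b]"]
      by (cases v) (simp add: w star_one_def flip: v_def)
  qed
  moreover have "star_one N p f (face A M (Suc p) w) = act N (act N (f (x, zs)) a) b"
    using zs by (simp add: w face_last star_one_def target.act_assoc del: face.simps)
  moreover have "act N (delta p f (x, zs @ [a])) b =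
    (\<Sum>i\<le>p. scl N ((-1) ^ i) (act N (f (face A M i (x, zs @ [a]))) b)) +
    scl N ((-1) ^ Suc p) (act N (act N (f (x, zs)) a) b)"
  proof -
    interpret Vector_Spaces.linear "scl N" "scl N" "\<lambda>y. act N y b"
      by (rule target.linear_act_left)
    show ?thesis by (simp add: delta_def diff sum scale)
  qed
  ultimately show "(\<Sum>i\<le>Suc p. scl N ((-1) ^ i) (star_one N p f (face A M i w))) =
      (case w of (x, zs) \<Rightarrow> act N (delta p f (x, butlast zs)) (last zs))"
    by (simp add: w butlast_append cong: sum.cong_simp)
qed

lemma star_one_Bar:
  assumes f: "f \<in> mod_hom A M p N m"
  shows "star_one N p f \<in> Bar A M N p m"
proof (rule BarI)
  show "star_one N p f \<in> mod_hom A M (p + 1) N m"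
  proof (rule mod_homI)
    fix x and zs us vs :: "'r list" and d ds
    show "Vector_Spaces.linear (scl M) (scl N) (\<lambda>x. star_one N p f (x, zs))" if "length zs = p + 1"
      using that linear_comp[OF mod_hom_linear_left[OF f] target.linear_act_left, of "butlast zs" "last zs"]
      by (simp add: star_one_def)
    show "Vector_Spaces.linear (scl A) (scl N) (\<lambda>a. star_one N p f (x, us @ a # vs))"
      if len: "length us + 1 + length vs = p + 1"
    proof (cases vs rule: rev_cases)
      case Nil
      then show ?thesis using len target.linear_act_right by (simp add: star_one_def)
    next
      case (snoc vs' v)
      then show ?thesis
        using len linear_comp[OF mod_hom_linear_right[OF f] target.linear_act_left, of us vs' x v]
        by (simp add: star_one_def butlast_append)
    qed
    show "star_one N p f (x, zs) \<in> gr N (d + sum_list ds + m)"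
      if zs: "length zs = p + 1" "list_all2 (\<lambda>a e. a \<in> gr A e) zs ds" and x: "x \<in> gr M d"
    proof -
      obtain us a where us: "zs = us @ [a]" "length us = p"
        using zs(1) by (auto simp: length_Suc_conv_rev)
      then obtain es e where "ds = es @ [e]" "list_all2 (\<lambda>a e. a \<in> gr A e) us es" "a \<in> gr A e"
        using zs(2) by (auto simp: list_all2_append1 list_all2_Cons1)
      then show ?thesis
        using us target.act_graded[OF mod_hom_graded[OF f us(2) x, of es], of a e]
        by (simp add: star_one_def algebra_simps)
    qed
  qed (simp add: star_one_def)
qed (simp add: star_one_def target.act_assoc)

section \<open>Recovering a map from its right linear extension by means of the unit\<close>

definition strip :: "nat \<Rightarrow> 'r \<Rightarrow> ('m \<times> 'r list \<Rightarrow> 'n) \<Rightarrow> 'm \<times> 'r list \<Rightarrow> 'n" where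
  "strip p e g = restrict (\<lambda>(x, zs). g (x, zs @ [e])) (words p)"

lemma strip_mod_hom:
  assumes g: "g \<in> Bar A M N p m" and e: "e \<in> gr A 0"
  shows "strip p e g \<in> mod_hom A M p N m"
proof (rule mod_homI)
  have g': "g \<in> mod_hom A M (p + 1) N m" using g by (simp add: Bar_def)
  fix x and zs us vs :: "'r list" and d ds
  show "Vector_Spaces.linear (scl M) (scl N) (\<lambda>x. strip p e g (x, zs))" if "length zs = p"
    using that mod_hom_linear_left[OF g', of "zs @ [e]"] by (simp add: strip_def)
  show "Vector_Spaces.linear (scl A) (scl N) (\<lambda>a. strip p e g (x, us @ a # vs))"
    if "length us + 1 + length vs = p"
    using that mod_hom_linear_right[OF g', of us "vs @ [e]" x] by (simp add: strip_def)
  show "strip p e g (x, zs) \<in> gr N (d + sum_list ds + m)"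
    if "length zs = p" "x \<in> gr M d" "list_all2 (\<lambda>a e. a \<in> gr A e) zs ds"
    \<comment> \<open>The appended unit has degree 0, so the total degree is unchanged.\<close>
    using that e mod_hom_graded[OF g', of "zs @ [e]" x d "ds @ [0]"]
    by (simp add: strip_def list_all2_appendI)
qed (simp add: strip_def)

text \<open>Right linearity moves \<open>a\<close> inside: acting with \<open>a\<close> on the value
  at a last entry \<open>e\<close> gives the value at \<open>mul A e a = a\<close>.\<close>

lemma star_one_strip:
  assumes "\<And>a. mul A e a = a" and g: "g \<in> Bar A M N p m"
  shows "star_one N p (strip p e g) = g"
proof
  fix w :: "'m \<times> 'r list"
  show "star_one N p (strip p e g) w = g w"
  proof (cases "w \<in> words (p + 1)")
    case True
    then obtain x zs a where w: "w = (x, zs @ [a])" and zs: "length zs = p"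
      by (cases w) (auto simp: length_Suc_conv_rev)
    then show ?thesis
      using g assms(1)[of a] by (auto simp: strip_def star_one_def Bar_def) metis
  next
    case False
    then show ?thesis
      using g mod_hom_extensional[of g A M "p + 1" N m]
      by (cases w) (simp add: star_one_def Bar_def extensional_def)
  qed
qed

text \<open>Putting \<open>e\<close> in the last place returns the value of \<open>f\<close>. Only
  values on \<open>words p\<close> enter \<open>star_one\<close>, which is why the right-hand side
  is limited to them.\<close>

lemma star_one_eq_iff:
  fixes f g :: "'m \<times> 'r list \<Rightarrow> 'n"
  assumes "\<And>y. act N y e = y"
  shows "star_one N p f = star_one N p g \<longleftrightarrow> (\<forall>w\<in>words p. f w = g w)"
proof
  assume eq: "star_one N p f = star_one N p g"
  show "\<forall>w\<in>words p. f w = g w"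
  proof
    fix w :: "'m \<times> 'r list" assume "w \<in> words p"
    then show "f w = g w"
      using fun_cong[OF eq, of "(fst w, snd w @ [e])"] assms by (cases w) (simp add: star_one_def)
  qed
next
  assume "\<forall>w\<in>words p. f w = g w"
  then show "star_one N p f = star_one N p g"
    by (auto simp: star_one_def restrict_def fun_eq_iff)
qed

lemma act_uminus: "act N (- y) a = - act N y a"
    using module_hom.neg[of "scl N" "scl N" "\<lambda>y. act N y a" y] target.linear_act_left
      Vector_Spaces.linear.axioms(3) by blast

lemma star_one_uminus:
  fixes f :: "'m \<times> 'r list \<Rightarrow> 'n"
  shows "star_one N p (\<lambda>w. - f w) = restrict (\<lambda>w. - star_one N p f w) (words (p + 1))"
  by (auto simp: star_one_def act_uminus restrict_def fun_eq_iff)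

lemma delta_uminus: "delta p (\<lambda>w. - f w) w = - delta p f w"
  by (cases w) (simp add: delta_def act_uminus sum_negf del: power_Suc sum.atMost_Suc)

end

section \<open>Minimal A-infinity structures\<close>

lemma graded_moduleD:
  assumes "graded_module V"
  shows "vector_space (scl V)" "module.subspace (scl V) (gr V d)"
  using assms by (simp_all add: graded_module_def)

text \<open>For \<open>g = 0\<close> every sign is 1 and the homogeneous parts add up to the vector.
  It is applied to \<open>m_2\<close>, whose degree is 0, so that inserting \<open>m_2\<close>
  produces no Koszul sign.\<close>

lemma koszul_0:
  assumes "graded_module V"
  shows "koszul V 0 v = v"
proof -
  interpret vector_space "scl V" by (rule graded_moduleD(1)[OF assms])
  have "\<exists>!c. decomposes V v c"
    using assms unfolding graded_module_def by (elim conjE) (erule spec)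
  then have "decomposes V v (part V v)"
    unfolding part_def by (rule theI')
  then have *: "v = (\<Sum>d | part V v d \<noteq> 0. part V v d)"
    unfolding decomposes_def by (elim conjE)
  have "koszul V 0 v = (\<Sum>d | part V v d \<noteq> 0. part V v d)"
    by (simp add: koszul_def)
  then show ?thesis using * by (rule trans[OF _ sym])
qed

text \<open>Sums over triples are grouped by \<open>s\<close>, with \<open>t\<close> determined by
  \<open>r\<close> and \<open>s\<close>. The bound on \<open>s\<close> keeps the subtractions of
  natural numbers exact.\<close>

lemma sum_triples:
  fixes g :: "nat \<Rightarrow> nat \<Rightarrow> nat \<Rightarrow> 'a::comm_monoid_add"
  assumes "\<And>s. s \<in> I \<Longrightarrow> s \<le> m"
  shows "(\<Sum>(r, s, t) \<in> {(r, s, t). s \<in> I \<and> r + s + t = m}. g r s t) =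
    (\<Sum>s\<in>I. \<Sum>r\<le>m - s. g r s (m - s - r))"
proof -
  have "finite I" by (rule finite_subset[of _ "{..m}"]) (use assms in auto)
  then have "(\<Sum>s\<in>I. \<Sum>r\<le>m - s. g r s (m - s - r)) =
      (\<Sum>(s, r)\<in>(SIGMA s:I. {..m - s}). g r s (m - s - r))"
    by (intro sum.Sigma) auto
  also have "\<dots> = (\<Sum>(r, s, t) \<in> {(r, s, t). s \<in> I \<and> r + s + t = m}. g r s t)"
  proof (rule sum.reindex_bij_witness[where i = "\<lambda>(r, s, t). (s, r)"
        and j = "\<lambda>(s, r). (r, s, m - s - r)"])
    show "(case a of (s, r) \<Rightarrow> (r, s, m - s - r)) \<in> {(r, s, t). s \<in> I \<and> r + s + t = m}"
      if "a \<in> (SIGMA s:I. {..m - s})" for a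
    proof -
      obtain s r where a: "a = (s, r)" "s \<in> I" "r \<le> m - s" using \<open>a \<in> _\<close> by auto
      then have "r + s + (m - s - r) = m" using assms[of s] by linarith
      then show ?thesis using a by simp
    qed
  qed auto
  finally show ?thesis by simp
qed

lemma sum_triples_pos:
  fixes g :: "nat \<Rightarrow> nat \<Rightarrow> nat \<Rightarrow> 'a::comm_monoid_add"
  shows "(\<Sum>(r, s, t) \<in> {(r, s, t). 1 \<le> s \<and> r + s + t = m}. g r s t) =
    (\<Sum>s=1..m. \<Sum>r\<le>m - s. g r s (m - s - r))"
proof -
  have eq: "{(r, s, t). 1 \<le> s \<and> r + s + t = m} = {(r, s, t). s \<in> {1..m} \<and> r + s + t = m}" by auto
  show ?thesis unfolding eq by (rule sum_triples) simp
qed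

text \<open>Associativity is the equation for \<open>m = 3\<close>. Its summands with
  \<open>s = 1\<close> put \<open>m_1 = 0\<close> into a slot of the multilinear \<open>m_3\<close>,
  and the one with \<open>s = 3\<close> applies \<open>m_1\<close>; the two with
  \<open>s = 2\<close> remain, with opposite signs.\<close>

lemma graded_algebra_assoc_algebra:
  assumes "minimal_A_inf_algebra R mR"
  shows "graded_algebra (assoc_algebra R mR)"
proof -
  have R: "graded_module R" and m1: "\<And>a. mR 1 [a] = 0"
    and hom: "\<And>i. 1 \<le> i \<Longrightarrow> mR i \<in> alg_hom R i (int i - 2)"
    using assms by (simp_all add: minimal_A_inf_algebra_def)
  interpret vector_space "scl R" by (rule graded_moduleD[OF R])
  have lin: "Vector_Spaces.linear (scl R) (scl R) (\<lambda>a. mR (length us + 1 + length vs) (us @ a # vs))"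
    for us vs
    using hom[of "length us + 1 + length vs"] by (auto simp: alg_hom_def)
  have "mR 2 [mR 2 [a, b], c] = mR 2 [a, mR 2 [b, c]]" for a b c
  proof -
    have "(\<Sum>(r, s, t) \<in> {(r, s, t). 1 \<le> s \<and> r + s + t = 3}.
        scl R ((-1) ^ (r + s * t)) (mR (r + t + 1) (ins_alg R mR r s [a, b, c]))) = 0"
      using assms by (simp add: minimal_A_inf_algebra_def)
    note this[unfolded sum_triples_pos]
    moreover have "mR 3 [0, d, e] = 0" "mR 3 [d, 0, e] = 0" "mR 3 [d, e, 0] = 0" for d e
      using linear_zero_arg[OF lin, of "[]" "[d, e]"] linear_zero_arg[OF lin, of "[d]" "[e]"]
        linear_zero_arg[OF lin, of "[d, e]" "[]"] by (simp_all add: numeral_3_eq_3)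
    ultimately show ?thesis
      using m1 by (simp add: ins_alg_def koszul_0[OF R] numeral_2_eq_2 numeral_3_eq_3)
  qed
  moreover have "mR 2 [a, b] \<in> gr R (d + e)" if "a \<in> gr R d" "b \<in> gr R e" for a b d e
  proof -
    have "mR 2 as \<in> gr R (sum_list ds + (int 2 - 2))"
      if "length as = 2" "list_all2 (\<lambda>a d. a \<in> gr R d) as ds" for as ds
      using hom[of 2] that unfolding alg_hom_def by simp
    from this[of "[a, b]" "[d, e]"] show ?thesis using that by simp
  qed
  moreover have "Vector_Spaces.linear (scl R) (scl R) (\<lambda>a. mR 2 [a, b])"
    "Vector_Spaces.linear (scl R) (scl R) (\<lambda>b. mR 2 [a, b])" for a b
    using lin[of "[]" "[b]"] lin[of "[a]" "[]"] by (simp_all add: numeral_2_eq_2)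
  ultimately show ?thesis
    by (intro graded_algebra.intro) (simp_all add: assoc_algebra_def)
qed

text \<open>Inserting \<open>m_1 = 0\<close> makes one slot zero, and a multilinear map vanishes
  there. This removes all summands with \<open>s = 1\<close> from the module equations.\<close>

lemma mod_hom_ins_mod_1:
  assumes f: "f \<in> mod_hom R X (r + t) X m" and w: "w \<in> words (r + t)"
    and "\<And>x. mX 1 (x, []) = 0" "\<And>a. mR 1 [a] = 0"
  shows "f (ins_mod R mR X mX r 1 w) = 0"
proof -
  obtain x zs where zs: "w = (x, zs)" "length zs = r + t" using w by (cases w) auto
  show ?thesis
  proof (cases r)
    case 0
    then show ?thesis
      using linear_zero_arg[OF mod_hom_linear_left[OF f]] zs assms(3) by (simp add: ins_mod_def)
  next
    case (Suc r')
    have "take 1 (drop r' zs) = [zs ! r']"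
      using zs Suc by (simp add: take_Suc_conv_app_nth)
    then show ?thesis
      using linear_zero_arg[OF mod_hom_linear_right[OF f],
          of "map (koszul R (int 1 - 2)) (take r' zs)" "drop (Suc r') zs"] zs assms(4) Suc
      by (simp add: ins_mod_def ins_alg_def)
  qed
qed

lemma
  assumes "minimal_A_module l R mR X mX"
  shows minimal_A_module_graded: "graded_module X"
    and minimal_A_module_hom: "1 \<le> i \<Longrightarrow> i \<le> l \<Longrightarrow> mX i \<in> mod_hom R X (i - 1) X (int i - 2)"
    and minimal_A_module_1: "1 \<le> l \<Longrightarrow> mX 1 (x, []) = 0"
    and minimal_A_module_equation: "1 \<le> m \<Longrightarrow> m \<le> l \<Longrightarrow> w \<in> words (m - 1) \<Longrightarrow>
      (\<Sum>(r, s, t) \<in> {(r, s, t). 1 \<le> s \<and> r + s + t = m}.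
         scl X ((-1) ^ (r + s * t)) (mX (r + t + 1) (ins_mod R mR X mX r s w))) = 0"
    and minimal_A_module_unit: "3 \<le> l \<Longrightarrow> alg_unit mR e \<Longrightarrow> mX 2 (x, [e]) = x"
  using assms by (simp_all add: minimal_A_module_def PiE_iff)

text \<open>The bound on \<open>l\<close> makes the third module equation available. With
  \<open>m_1 = 0\<close> it reduces to associativity of the action.\<close>

lemma graded_right_module_assoc_module:
  assumes R: "minimal_A_inf_algebra R mR" and X: "minimal_A_module l R mR X mX" and l: "3 \<le> l"
  shows "graded_right_module (assoc_algebra R mR) (assoc_module X mX)"
proof -
  interpret graded_algebra "assoc_algebra R mR"
    by (rule graded_algebra_assoc_algebra[OF R])
  note gX = minimal_A_module_graded[OF X]
  have Rg: "graded_module R" and R1: "\<And>a. mR 1 [a] = 0"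
    using R by (simp_all add: minimal_A_inf_algebra_def)
  interpret vector_space "scl X" by (rule graded_moduleD[OF gX])
  have hom: "mX 2 \<in> mod_hom R X 1 X 0" "mX 3 \<in> mod_hom R X 2 X 1"
    using minimal_A_module_hom[OF X, of 2] minimal_A_module_hom[OF X, of 3] l by auto
  note m1 = minimal_A_module_1[OF X]
  have "mX 2 (mX 2 (x, [a]), [b]) = mX 2 (x, [mR 2 [a, b]])" for x a b
  proof -
    have "mX 3 (ins_mod R mR X mX r 1 (x, [a, b])) = 0" if "r + t = 2" for r t
    proof (rule mod_hom_ins_mod_1)
      show "mX 3 \<in> mod_hom R X (r + t) X 1" using hom(2) that by simp
      show "mX 1 (x, []) = 0" for x using m1 l by simp
    qed (use that R1 in simp_all)
    note this[of 0 2, simplified] this[of 1 1, simplified] this[of 2 0, simplified]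
    then show ?thesis
      using minimal_A_module_equation[OF X, of 3 "(x, [a, b])", unfolded sum_triples_pos] l m1
      by (simp add: ins_mod_def ins_alg_def koszul_0[OF gX] koszul_0[OF Rg]
          numeral_2_eq_2 numeral_3_eq_3)
  qed
  moreover have "mX 2 (x, [a]) \<in> gr X (d + e)" if "x \<in> gr X d" "a \<in> gr R e" for x a d e
    using mod_hom_graded[OF hom(1) _ that(1), of "[a]" "[e]"] that(2) by simp
  ultimately show ?thesis
    using vector_space_axioms graded_moduleD(2)[OF gX] mod_hom_linear_left[OF hom(1), of "[_]"]
      mod_hom_linear_right[OF hom(1), of "[]" "[]"]
    by (intro graded_right_module.intro graded_right_module_axioms.intro graded_algebra_axioms)
      (simp_all add: assoc_algebra_def assoc_module_def)
qed

section \<open>Extensions of a minimal module structure\<close>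

text \<open>Both sides apply a binary product at position \<open>i\<close>; the Koszul signs on the
  left factors are trivial since \<open>m_2\<close> has degree 0.\<close>

lemma face_eq_ins_mod:
  assumes "graded_module R" "graded_module X" "length zs = Suc p" "i \<le> p"
  shows "face (assoc_algebra R mR) (assoc_module X mX) i (x, zs) = ins_mod R mR X mX i 2 (x, zs)"
proof (cases i)
  case 0
  then show ?thesis
    using assms(3) by (cases zs) (simp_all add: assoc_module_def ins_mod_def)
next
  case (Suc j)
  have "take 2 (drop j zs) = [zs ! j, zs ! Suc j]"
    using assms(3,4) Suc by (simp add: take_Suc_conv_app_nth numeral_2_eq_2)
  then show ?thesis
    using assms Suc
    by (simp add: contract_conv assoc_algebra_def ins_mod_def ins_alg_def koszul_0 map_idI)
qed

locale minimal_module_extension =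
  fixes R :: "('k::field, 'r::ab_group_add) gmod"
    and mR :: "nat \<Rightarrow> 'r list \<Rightarrow> 'r"
    and X :: "('k, 'x::ab_group_add) gmod"
    and mX :: "nat \<Rightarrow> 'x \<times> 'r list \<Rightarrow> 'x"
    and n :: nat
  assumes algebra: "minimal_A_inf_algebra R mR"
    and n: "3 \<le> n"
    and module: "minimal_A_module n R mR X mX"
begin

abbreviation "A \<equiv> assoc_algebra R mR"
abbreviation "M \<equiv> assoc_module X mX"
abbreviation "cochains p m \<equiv> mod_hom R X p X m"

lemma graded: "graded_module R" "graded_module X"
  using algebra minimal_A_module_graded[OF module] by (simp_all add: minimal_A_inf_algebra_def)

lemma mR_1: "mR 1 [a] = 0"
  using algebra by (simp add: minimal_A_inf_algebra_def)

lemma cochains_eq: "mod_hom A M p M m = cochains p m"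
  by (rule mod_hom_cong) (simp_all add: assoc_algebra_def assoc_module_def)

lemma scl_M: "scl M = scl X" and act_M: "act M x a = mX 2 (x, [a])"
  by (simp_all add: assoc_module_def)

sublocale bar_complex A M M
  using graded_right_module_assoc_module[OF algebra module n] by (intro bar_complex.intro)

text \<open>Here \<open>mX' n\<close> and \<open>mX' (n + 1)\<close> are arbitrary graded
  multilinear maps and everything below is fixed. This isolates what the module equations impose on
  the two top operations.\<close>

definition candidates :: "(nat \<Rightarrow> 'x \<times> 'r list \<Rightarrow> 'x) set" where
  "candidates = {mX' \<in> \<Pi>\<^sub>E i\<in>{1..n + 1}. cochains (i - 1) (int i - 2). \<forall>i\<in>{1..n - 1}. mX' i = mX i}"

lemma candidatesD:
  assumes "mX' \<in> candidates"
  shows "1 \<le> i \<Longrightarrow> i \<le> n + 1 \<Longrightarrow> mX' i \<in> cochains (i - 1) (int i - 2)"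
    and "1 \<le> i \<Longrightarrow> i < n \<Longrightarrow> mX' i = mX i"
    and "mX' 1 (x, []) = 0"
proof -
  show "mX' i \<in> cochains (i - 1) (int i - 2)" if "1 \<le> i" "i \<le> n + 1"
    using assms that by (auto simp: candidates_def PiE_iff)
  show *: "mX' i = mX i" if "1 \<le> i" "i < n" for i
    using assms that by (auto simp: candidates_def)
  show "mX' 1 (x, []) = 0"
    using *[of 1] n minimal_A_module_1[OF module] by simp
qed

section \<open>The module equations of a candidate\<close>

lemma ins_mod_1_zero:
  assumes "mX' \<in> candidates" "r + t \<le> n" "w \<in> words (r + t)"
  shows "mX' (r + t + 1) (ins_mod R mR X mX' r 1 w) = 0"
proof (rule mod_hom_ins_mod_1)
  show "mX' (r + t + 1) \<in> cochains (r + t) (int (r + t + 1) - 2)"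
    using candidatesD(1)[OF assms(1), of "r + t + 1"] assms(2) by simp
qed (use assms candidatesD(3)[OF assms(1)] mR_1 in simp_all)

lemma ins_mod_full_zero:
  assumes "mX' \<in> candidates" "w \<in> words (s - 1)"
  shows "mX' 1 (ins_mod R mR X mX' 0 s w) = 0"
  using assms candidatesD(3)[OF assms(1)] by (cases w) (simp add: ins_mod_def)

lemma ins_mod_cong:
  "mX' s = mX'' s \<or> r \<noteq> 0 \<Longrightarrow> ins_mod R mR X mX' r s w = ins_mod R mR X mX'' r s w"
  by (cases w) (auto simp: ins_mod_def)

text \<open>Since \<open>m\<^sub>1 = 0\<close>, the \<open>m\<close>-th equation only involves \<open>m\<^sub>i\<close> with \<open>i < m\<close>.\<close>

lemma candidates_equation_low:
  assumes mX': "mX' \<in> candidates" and m: "m \<in> {1..n}" "w \<in> words (m - 1)"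
  shows "(\<Sum>(r, s, t) \<in> {(r, s, t). 1 \<le> s \<and> r + s + t = m}.
    scl X ((-1) ^ (r + s * t)) (mX' (r + t + 1) (ins_mod R mR X mX' r s w))) = 0"
proof -
  have "mX' (r + t + 1) (ins_mod R mR X mX' r s w) = mX (r + t + 1) (ins_mod R mR X mX r s w)"
    if rst: "1 \<le> s" "r + s + t = m" for r s t
  proof -
    \<comment> \<open>In the first two cases both sides are zero, through an inner or an outer
      \<open>m_1\<close>. Otherwise \<open>s\<close> and \<open>r + t + 1\<close> are both below
      \<open>m\<close>, hence below \<open>n\<close>, where the two structures agree.\<close>
    consider "s = 1" | "r = 0" "t = 0" "s = m" | "1 < s" "s < m" using rst by linarith
    then show ?thesis
    proof cases
      case 1
      then have "m - 1 = r + t" using rst by linarith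
      with m(2) have w: "w \<in> words (r + t)" by simp
      have le: "r + t + 1 \<le> n" using rst 1 m by simp
      have "mX (r + t + 1) \<in> cochains (r + t) (int (r + t + 1) - 2)"
        using minimal_A_module_hom[OF module _ le] by simp
      then have "mX (r + t + 1) (ins_mod R mR X mX r 1 w) = 0"
        by (rule mod_hom_ins_mod_1) (use w mR_1 minimal_A_module_1[OF module] n in simp_all)
      then show ?thesis
        using ins_mod_1_zero[OF mX' _ w] le 1 by simp
    next
      case 2
      have "mX 1 (ins_mod R mR X mX 0 s w) = 0"
        using m 2 n minimal_A_module_1[OF module] by (cases w) (simp add: ins_mod_def)
      then show ?thesis
        using ins_mod_full_zero[OF mX', of w s] 2 m by simp
    next
      case 3
      then have "mX' (r + t + 1) = mX (r + t + 1)" "mX' s = mX s"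
        using rst m by (auto intro!: candidatesD(2)[OF mX'])
      then show ?thesis using ins_mod_cong[of mX' s mX r w] by simp
    qed
  qed
  then have "(\<Sum>(r, s, t) \<in> {(r, s, t). 1 \<le> s \<and> r + s + t = m}.
      scl X ((-1) ^ (r + s * t)) (mX' (r + t + 1) (ins_mod R mR X mX' r s w))) =
    (\<Sum>(r, s, t) \<in> {(r, s, t). 1 \<le> s \<and> r + s + t = m}.
      scl X ((-1) ^ (r + s * t)) (mX (r + t + 1) (ins_mod R mR X mX r s w)))"
    by (intro sum.cong refl) (clarsimp split: prod.splits)
  then show ?thesis
    using minimal_A_module_equation[OF module] m by simp
qed

text \<open>
  In the equation for \<open>n + 1\<close> the summands with \<open>s = 2\<close>, together with \<open>m\<^sub>2(m\<^sub>n \<otimes> 1)\<close>, are the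
  Hochschild type coboundary of \<open>m\<^sub>n\<close>, those with \<open>s \<in> {1, n + 1}\<close> vanish, and the remaining ones
  only involve \<open>m\<^sub>i\<close> with \<open>i < n\<close>.
\<close>

lemma candidates_equation_top:
  assumes mX': "mX' \<in> candidates" and w: "w \<in> words n"
  shows "(\<Sum>(r, s, t) \<in> {(r, s, t). 1 \<le> s \<and> r + s + t = n + 1}.
      scl X ((-1) ^ (r + s * t)) (mX' (r + t + 1) (ins_mod R mR X mX' r s w))) =
    delta (n - 1) (mX' n) w + phi R mR X mX n w"
proof -
  define T where "T r s t = scl X ((-1) ^ (r + s * t)) (mX' (r + t + 1) (ins_mod R mR X mX' r s w))"
    for r s t
  interpret X: vector_space "scl X" by (rule graded_moduleD(1)[OF graded(2)])
  define U where "U s = (\<Sum>r\<le>n + 1 - s. T r s (n + 1 - s - r))" for s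
  obtain x zs where xzs: "w = (x, zs)" "length zs = n" using w by (cases w) auto
  have mX'2: "mX' 2 = mX 2" using candidatesD(2)[OF mX'] n by simp
  have U1: "U 1 = 0"
    unfolding U_def T_def
  proof (rule sum.neutral, rule ballI)
    fix r assume "r \<in> {..n + 1 - 1}"
    then show "scl X ((-1) ^ (r + 1 * (n + 1 - 1 - r)))
        (mX' (r + (n + 1 - 1 - r) + 1) (ins_mod R mR X mX' r 1 w)) = 0"
      using ins_mod_1_zero[OF mX', of r "n - r" w] w by simp
  qed
  have U2: "U 2 = (\<Sum>i\<le>n - 1. scl X ((-1) ^ i) (mX' n (face A M i w)))"
    unfolding U_def
  proof (rule sum.cong)
    fix i assume i: "i \<in> {..n - 1}"
    have "ins_mod R mR X mX' i 2 w = face A M i w"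
      using face_eq_ins_mod[OF graded, of zs "n - 1" i mR mX x] i n xzs ins_mod_cong[of mX' 2 mX i w] mX'2
      by simp
    \<comment> \<open>For \<open>s = 2\<close> the sign exponent is \<open>i + 2t\<close>, which has
      the parity of \<open>i\<close>.\<close>
    then show "T i 2 (n + 1 - 2 - i) = scl X ((-1) ^ i) (mX' n (face A M i w))"
      using i n by (simp add: T_def power_add power_mult)
  qed (use n in simp)
  \<comment> \<open>Only \<open>(0, n, 1)\<close> and \<open>(1, n, 0)\<close> have
    \<open>s = n\<close>. The first, with sign exponent \<open>n\<close>, closes
    \<open>delta (n - 1)\<close>; the second does not involve \<open>mX' n\<close>, since for
    \<open>r > 0\<close> the inserted operation comes from the algebra, and is the leading term of
    \<open>phi\<close>.\<close>
  have Un: "U n = scl X ((-1) ^ n) (mX 2 (mX' n (x, butlast zs), [last zs])) - mX 2 (ins_mod R mR X mX 1 n w)"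
  proof -
    obtain us a where "zs = us @ [a]"
      using xzs n by (cases zs rule: rev_cases) auto
    then have "take (n - 1) zs = butlast zs" "drop (n - 1) zs = [last zs]"
      using xzs(2) by auto
    then have "T 0 n 1 = scl X ((-1) ^ n) (mX 2 (mX' n (x, butlast zs), [last zs]))"
      by (simp add: T_def xzs(1) ins_mod_def mX'2[unfolded numeral_2_eq_2] numeral_2_eq_2)
    moreover have "T 1 n 0 = - mX 2 (ins_mod R mR X mX 1 n w)"
      using ins_mod_cong[of mX' n mX 1 w] by (simp add: T_def mX'2[unfolded numeral_2_eq_2] numeral_2_eq_2)
    moreover have "{..n + 1 - n} = {0, 1}" by auto
    ultimately show ?thesis by (simp add: U_def)
  qed
  have Un1: "U (n + 1) = 0"
    using ins_mod_full_zero[OF mX', of w "n + 1"] w by (simp add: U_def T_def)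
  have mid: "(\<Sum>s=3..n - 1. U s) =
    (\<Sum>(r, s, t) \<in> {(r, s, t). 2 < r + t + 1 \<and> r + t + 1 < n \<and> r + s + t = n + 1}.
        scl X ((-1) ^ (r + s * t)) (mX (r + t + 1) (ins_mod R mR X mX r s w)))"
  proof -
    have "(\<Sum>s=3..n - 1. U s) = (\<Sum>(r, s, t) \<in> {(r, s, t). s \<in> {3..n - 1} \<and> r + s + t = n + 1}. T r s t)"
      unfolding U_def by (rule sum_triples[symmetric]) auto
    also have "\<dots> = (\<Sum>(r, s, t) \<in> {(r, s, t). 2 < r + t + 1 \<and> r + t + 1 < n \<and> r + s + t = n + 1}.
        scl X ((-1) ^ (r + s * t)) (mX (r + t + 1) (ins_mod R mR X mX r s w)))"
    proof (rule sum.cong)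
      \<comment> \<open>Since \<open>r + t + 1 = n + 2 - s\<close>, the bounds on the outer index in
        \<open>phi\<close> say exactly that \<open>s\<close> lies strictly between 2 and
        \<open>n\<close>.\<close>
      show "{(r, s, t). s \<in> {3..n - 1} \<and> r + s + t = n + 1} =
          {(r, s, t). 2 < r + t + 1 \<and> r + t + 1 < n \<and> r + s + t = n + 1}"
        by auto
    next
      fix q assume "q \<in> {(r, s, t). 2 < r + t + 1 \<and> r + t + 1 < n \<and> r + s + t = n + 1}"
      then obtain r s t where q: "q = (r, s, t)" "2 < r + t + 1" "r + t + 1 < n" "r + s + t = n + 1"
        by auto
      then have "mX' (r + t + 1) = mX (r + t + 1)" "mX' s = mX s"
        by (auto intro!: candidatesD(2)[OF mX'])
      then show "(case q of (r, s, t) \<Rightarrow> T r s t) = (case q of (r, s, t) \<Rightarrow>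
          scl X ((-1) ^ (r + s * t)) (mX (r + t + 1) (ins_mod R mR X mX r s w)))"
        using ins_mod_cong[of mX' s mX r w] by (simp add: q(1) T_def)
    qed
    finally show ?thesis .
  qed
  have "(\<Sum>(r, s, t) \<in> {(r, s, t). 1 \<le> s \<and> r + s + t = n + 1}. T r s t) = (\<Sum>s=1..n + 1. U s)"
    unfolding U_def by (rule sum_triples_pos)
  also have "{1..n + 1} = {1, 2, n, n + 1} \<union> {3..n - 1}" using n by auto
  also have "(\<Sum>s\<in>{1, 2, n, n + 1} \<union> {3..n - 1}. U s) = U 1 + U 2 + U n + U (n + 1) + (\<Sum>s=3..n - 1. U s)"
    using n by (subst sum.union_disjoint) (auto simp: add.assoc)
  also have "\<dots> = delta (n - 1) (mX' n) w + phi R mR X mX n w"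
    unfolding U1 U2 Un Un1 mid using w n
    by (simp add: delta_def phi_def xzs(1) scl_M act_M)
  finally show ?thesis unfolding T_def .
qed


abbreviation "\<Phi> \<equiv> star_one M n (phi R mR X mX n)"

lemma A_extensions_subset_candidates:
  assumes "mX' \<in> A_extensions (n - 1) (n + 1) R mR X mX"
  shows "mX' \<in> candidates"
proof -
  have "minimal_A_module (n + 1) R mR X mX'" and eq: "restrict mX' {1..n - 1} = restrict mX {1..n - 1}"
    using assms by (auto simp: A_extensions_def)
  moreover have "mX' i = mX i" if "i \<in> {1..n - 1}" for i
    using fun_cong[OF eq, of i] that by simp
  ultimately show ?thesis
    unfolding candidates_def minimal_A_module_def by blast
qed

lemma obtain_unit:
  obtains e where "e \<in> gr A 0" "\<And>a. mul A e a = a" "\<And>x. act M x e = x"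
proof -
  obtain e where "e \<in> gr R 0" "alg_unit mR e"
    using algebra by (auto simp: minimal_A_inf_algebra_def)
  then show ?thesis
    using that[of e] minimal_A_module_unit[OF module n]
    by (simp add: alg_unit_def assoc_algebra_def act_M)
qed

text \<open>For a candidate the equations up to \<open>n\<close> hold already. The one for
  \<open>n + 1\<close> constrains \<open>mX' n\<close> alone, and moving \<open>delta\<close> to the
  other side produces the minus sign. The unit makes the passage to \<open>star_one\<close>
  reversible.\<close>

lemma A_extensions_iff:
  "mX' \<in> A_extensions (n - 1) (n + 1) R mR X mX \<longleftrightarrow> mX' \<in> candidates \<and>
    bar_coboundary A M M (n - 1) (star_one M (n - 1) (\<lambda>w. - mX' n w)) = \<Phi>"
proof (cases "mX' \<in> candidates")
  case True
  obtain e where e: "\<And>x. act M x e = x" by (rule obtain_unit) blast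
  let ?eq = "\<lambda>m w. (\<Sum>(r, s, t) \<in> {(r, s, t). 1 \<le> s \<and> r + s + t = m}.
    scl X ((-1) ^ (r + s * t)) (mX' (r + t + 1) (ins_mod R mR X mX' r s w))) = 0"
  \<comment> \<open>The conditions besides the equations are typing, agreement below
    \<open>n\<close>, and statements about the operations 1 and 2; the latter are inherited from
    \<open>mX\<close> because \<open>n\<close> is at least 3.\<close>
  have "restrict mX' {1..n - 1} = restrict mX {1..n - 1}"
    using True by (auto simp: candidates_def intro: restrict_ext)
  moreover have "\<forall>x. mX' 1 (x, []) = 0"
    using candidatesD(3)[OF True] by blast
  moreover have "mX' 2 = mX 2"
    using candidatesD(2)[OF True, of 2] n by simp
  then have "3 \<le> n + 1 \<longrightarrow> (\<forall>e. alg_unit mR e \<longrightarrow> (\<forall>x. mX' 2 (x, [e]) = x))"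
    using minimal_A_module_unit[OF module n] by simp
  moreover have "mX' \<in> (\<Pi>\<^sub>E i\<in>{1..n + 1}. cochains (i - 1) (int i - 2))"
    using True by (simp add: candidates_def)
  ultimately have "mX' \<in> A_extensions (n - 1) (n + 1) R mR X mX \<longleftrightarrow>
      (\<forall>m\<in>{1..n + 1}. \<forall>w\<in>words (m - 1). ?eq m w)"
    using graded(2) unfolding A_extensions_def minimal_A_module_def mem_Collect_eq by blast
  also have "{1..n + 1} = insert (n + 1) {1..n}" by auto
  also have "(\<forall>m\<in>insert (n + 1) {1..n}. \<forall>w\<in>words (m - 1). ?eq m w) \<longleftrightarrow>
      (\<forall>w\<in>words n. ?eq (n + 1) w)"
    using candidates_equation_low[OF True] by simp
  also have "\<dots> \<longleftrightarrow> (\<forall>w\<in>words n. - delta (n - 1) (mX' n) w = phi R mR X mX n w)"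
    unfolding neg_eq_iff_add_eq_0 by (rule ball_cong[OF refl]) (simp only: candidates_equation_top[OF True])
  also have "\<dots> \<longleftrightarrow> star_one M n (delta (n - 1) (\<lambda>w. - mX' n w)) = \<Phi>"
    unfolding star_one_eq_iff[OF e] delta_uminus ..
  also have "star_one M n (delta (n - 1) (\<lambda>w. - mX' n w)) =
      bar_coboundary A M M (n - 1) (star_one M (n - 1) (\<lambda>w. - mX' n w))"
    using n by (simp add: bar_coboundary_star_one)
  finally show ?thesis using True by simp
qed (use A_extensions_subset_candidates in blast)

section \<open>The bijection with pairs of bar cochains\<close>

definition bar_pair ::
  "(nat \<Rightarrow> 'x \<times> 'r list \<Rightarrow> 'x) \<Rightarrow> ('x \<times> 'r list \<Rightarrow> 'x) \<times> ('x \<times> 'r list \<Rightarrow> 'x)" where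
  "bar_pair mX' = (star_one M (n - 1) (\<lambda>w. - mX' n w), star_one M n (mX' (n + 1)))"

text \<open>A cochain in bar degree \<open>p\<close> has \<open>p + 1\<close> factors of the algebra
  in its source, so bar degrees \<open>n - 1\<close> and \<open>n\<close> stand for \<open>n\<close>
  and \<open>n + 1\<close> factors.\<close>

definition bar_pairs :: "(('x \<times> 'r list \<Rightarrow> 'x) \<times> ('x \<times> 'r list \<Rightarrow> 'x)) set" where
  "bar_pairs = {(\<psi>, \<xi>). \<psi> \<in> Bar A M M (n - 1) (int n - 2) \<and> \<xi> \<in> Bar A M M n (int n - 1) \<and>
    bar_coboundary A M M (n - 1) \<psi> = \<Phi>}"

text \<open>The unit recovers both top operations on words of the right length, extensionality fixes
  them elsewhere, and the lower operations are those of \<open>mX\<close>.\<close>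

lemma inj_on_bar_pair: "inj_on bar_pair candidates"
proof (rule inj_onI)
  fix f g assume f: "f \<in> candidates" and g: "g \<in> candidates" and eq: "bar_pair f = bar_pair g"
  obtain e where e: "\<And>x. act M x e = x" by (rule obtain_unit) blast
  have eqs: "(\<forall>w\<in>words (n - 1). - f n w = - g n w) \<and> (\<forall>w\<in>words n. f (n + 1) w = g (n + 1) w)"
    using eq unfolding bar_pair_def by (simp only: prod.inject star_one_eq_iff[OF e])
  have hom: "h i \<in> extensional (words (i - 1))" if "h \<in> candidates" "i \<in> {1..n + 1}" for h i
    using candidatesD(1)[OF that(1), of i] that(2) by (intro mod_hom_extensional) auto
  have "f i = g i" if i: "i \<in> {1..n + 1}" for i
  proof -
    consider "i < n" | "i = n" | "i = n + 1" using i by fastforce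
    then show ?thesis
    proof cases
      case 1
      then show ?thesis using candidatesD(2)[OF f] candidatesD(2)[OF g] i by simp
    next
      case 2
      then show ?thesis
        using eqs extensionalityI[OF hom[OF f i] hom[OF g i]] 2 by simp
    next
      case 3
      then show ?thesis
        using eqs extensionalityI[OF hom[OF f i] hom[OF g i]] 3 by simp
    qed
  qed
  moreover have "f \<in> extensional {1..n + 1}" "g \<in> extensional {1..n + 1}"
    using f g by (auto simp: candidates_def PiE_def)
  ultimately show "f = g" by (rule extensionalityI[rotated 2])
qed

lemma star_one_minus_Bar:
  assumes "f \<in> cochains p m"
  shows "star_one M p (\<lambda>w. - f w) \<in> Bar A M M p m"
  unfolding star_one_uminus
  by (intro Bar_uminus star_one_Bar) (simp only: cochains_eq assms)

lemma bij_betw_bar_pair: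
  "bij_betw bar_pair (A_extensions (n - 1) (n + 1) R mR X mX) bar_pairs"
proof (rule bij_betw_imageI)
  show "inj_on bar_pair (A_extensions (n - 1) (n + 1) R mR X mX)"
    by (rule inj_on_subset[OF inj_on_bar_pair]) (use A_extensions_subset_candidates in blast)
  show "bar_pair ` A_extensions (n - 1) (n + 1) R mR X mX = bar_pairs"
  proof (intro equalityI subsetI)
    fix q assume "q \<in> bar_pair ` A_extensions (n - 1) (n + 1) R mR X mX"
    then obtain f where q: "q = bar_pair f" and f: "f \<in> candidates"
      "bar_coboundary A M M (n - 1) (star_one M (n - 1) (\<lambda>w. - f n w)) = \<Phi>"
      using A_extensions_iff by auto
    have "star_one M (n - 1) (\<lambda>w. - f n w) \<in> Bar A M M (n - 1) (int n - 2)"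
      using candidatesD(1)[OF f(1), of n] n by (intro star_one_minus_Bar) simp
    moreover have "star_one M n (f (n + 1)) \<in> Bar A M M n (int n - 1)"
      using candidatesD(1)[OF f(1), of "n + 1"] by (intro star_one_Bar) (simp add: cochains_eq)
    ultimately show "q \<in> bar_pairs"
      using f(2) by (simp add: q bar_pair_def bar_pairs_def)
  next
    fix q assume "q \<in> bar_pairs"
    then obtain \<psi> \<xi> where q: "q = (\<psi>, \<xi>)" and \<psi>: "\<psi> \<in> Bar A M M (n - 1) (int n - 2)"
      and \<xi>: "\<xi> \<in> Bar A M M n (int n - 1)" and d: "bar_coboundary A M M (n - 1) \<psi> = \<Phi>"
      by (auto simp: bar_pairs_def)
    obtain e where e: "e \<in> gr A 0" "\<And>a. mul A e a = a" by (rule obtain_unit) blast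
    \<comment> \<open>The negative undoes the sign in \<open>bar_pair\<close>; restricting keeps it
      extensional, hence a bar cochain.\<close>
    define \<psi>' where "\<psi>' = restrict (\<lambda>w. - \<psi> w) (words (n - 1 + 1))"
    have \<psi>': "\<psi>' \<in> Bar A M M (n - 1) (int n - 2)"
      unfolding \<psi>'_def by (rule Bar_uminus[OF \<psi>])
    \<comment> \<open>The preimage keeps \<open>mX\<close> below \<open>n\<close> and takes its two
      top operations by evaluating \<open>\<psi>'\<close> and \<open>\<xi>\<close> at the
      unit.\<close>
    define f where "f = (\<lambda>i\<in>{1..n + 1}.
      if i = n then strip (n - 1) e \<psi>' else if i = n + 1 then strip n e \<xi> else mX i)"
    have f: "f \<in> candidates"
      unfolding candidates_def
    proof (intro CollectI conjI PiE_I ballI)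
      fix i assume i: "i \<in> {1..n + 1}"
      consider "i < n" | "i = n" | "i = n + 1" using i by fastforce
      then show "f i \<in> cochains (i - 1) (int i - 2)"
      proof cases
        case 1
        then show ?thesis
          using i minimal_A_module_hom[OF module, of i] by (simp add: f_def)
      next
        case 2
        then show ?thesis
          using i strip_mod_hom[OF \<psi>' e(1)] by (simp add: f_def cochains_eq)
      next
        case 3
        then show ?thesis
          using i strip_mod_hom[OF \<xi> e(1)] by (simp add: f_def cochains_eq)
      qed
    qed (auto simp: f_def)
    have pair: "bar_pair f = q"
    proof -
      have "\<psi> \<in> extensional (words (n - 1 + 1))"
        using \<psi> mod_hom_extensional by (auto simp: Bar_def)
      then have "restrict (\<lambda>w. - \<psi>' w) (words (n - 1 + 1)) = \<psi>"
        by (auto simp: \<psi>'_def restrict_def extensional_def fun_eq_iff)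
      moreover have "f n = strip (n - 1) e \<psi>'" using n by (simp add: f_def)
      ultimately have "star_one M (n - 1) (\<lambda>w. - f n w) = \<psi>"
        unfolding star_one_uminus by (simp only: star_one_strip[OF e(2) \<psi>'])
      moreover have "star_one M n (f (n + 1)) = \<xi>"
        by (simp add: f_def star_one_strip[OF e(2) \<xi>])
      ultimately show ?thesis by (simp add: bar_pair_def q)
    qed
    then have "star_one M (n - 1) (\<lambda>w. - f n w) = \<psi>"
      unfolding bar_pair_def q by (rule conjunct1[OF prod.inject[THEN iffD1]])
    with f d have "f \<in> A_extensions (n - 1) (n + 1) R mR X mX"
      unfolding A_extensions_iff by simp
    with pair show "q \<in> bar_pair ` A_extensions (n - 1) (n + 1) R mR X mX" by blast
  qed
qed

text \<open>The set is a product because the condition involves only \<open>\<psi>\<close>. The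
  factor of all \<open>\<xi>\<close> contains the zero cochain, so nonemptiness says precisely that
  \<open>\<Phi>\<close> is a coboundary.\<close>

lemma bar_pairs_nonempty_iff:
  "bar_pairs \<noteq> {} \<longleftrightarrow> Ext_class A M M n (int n - 2) \<Phi> = Ext_zero A M M n (int n - 2)"
proof -
  have image: "y \<in> h ` B \<longleftrightarrow> {x \<in> B. h x = y} \<noteq> {}" for y :: 'c and h :: "'d \<Rightarrow> 'c" and B
    by blast
  have "bar_pairs = {\<psi> \<in> Bar A M M (n - 1) (int n - 2). bar_coboundary A M M (n - 1) \<psi> = \<Phi>} \<times>
      Bar A M M n (int n - 1)"
    by (auto simp: bar_pairs_def)
  then have "bar_pairs \<noteq> {} \<longleftrightarrow>
      \<Phi> \<in> bar_coboundary A M M (n - 1) ` Bar A M M (n - 1) (int n - 2)"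
    using zero_cochain_Bar[of n "int n - 1"] by (auto simp only: image Times_empty)
  then show ?thesis
    using n unfolding Ext_class_eq_Ext_zero_iff bar_coboundaries_def by simp
qed

end

theorem proposition3p4:
  fixes R :: "('k::field, 'r::ab_group_add) gmod"
    and mR :: "nat \<Rightarrow> 'r list \<Rightarrow> 'r"
    and X :: "('k, 'x::ab_group_add) gmod"
    and mX :: "nat \<Rightarrow> 'x \<times> 'r list \<Rightarrow> 'x"
    and n :: nat
  assumes "minimal_A_inf_algebra R mR"
    and "3 \<le> n"
    and "minimal_A_module n R mR X mX"
  shows
    "let A = assoc_algebra R mR;
         M = assoc_module X mX;
         \<phi>1 = star_one M n (phi R mR X mX n);
         vanishes = (Ext_class A M M n (int n - 2) \<phi>1 = Ext_zero A M M n (int n - 2))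
     in
       (A_extensions (n - 1) (n + 1) R mR X mX \<noteq> {} \<longleftrightarrow> vanishes) \<and>
       (vanishes \<longrightarrow>
         (\<exists>F. bij_betw F
           (A_extensions (n - 1) (n + 1) R mR X mX)
           {(\<psi>, \<xi>). \<psi> \<in> Bar A M M (n - 1) (int n - 2) \<and> \<xi> \<in> Bar A M M n (int n - 1) \<and>
              bar_coboundary A M M (n - 1) \<psi> = \<phi>1}))"
proof -
  interpret minimal_module_extension R mR X mX n
    by (rule minimal_module_extension.intro) (fact assms)+
  have "A_extensions (n - 1) (n + 1) R mR X mX \<noteq> {} \<longleftrightarrow> bar_pairs \<noteq> {}"
    using bij_betw_bar_pair by (auto simp: bij_betw_def)
  then show ?thesis
    using bij_betw_bar_pair unfolding Let_def bar_pairs_nonempty_iff[symmetric] bar_pairs_def by blast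
qed

end
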